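(* For $(z,\tau)\in\mathbb{C}^2\times\mathbb{H}_2$ with $\theta(z,\tau)=0$, the formula $$\eta(z,\tau)^3=\pm\pi^{12}\prod_{\varepsilon\ \mathrm{even}}\theta[\varepsilon](0,\tau)^2\cdot\theta(3z,\tau)$$ holds, where the product runs over the ten even theta characteristics in dimension $2$ and $\eta=\theta_{11}\theta_2^2-2\theta_{12}\theta_1\theta_2+\theta_{22}\theta_1^2$.
   Context: $\mathbb{H}_2$ is the Siegel upper half space of degree $2$; vectors are column vectors, ${}^t$ is transpose. For $a,b$ column vectors of dimension $2$ with entries in $\{0,1/2\}$, the theta function with characteristic $\varepsilon=\left[{a\atop b}\right]$ on $\mathbb{C}^2\times\mathbb{H}_2$ is $$\theta\left[{a\atop b}\right](z,\tau)=\sum_{m\in\mathbb{Z}^2}e^{\pi i\,{}^t(m+a)\tau(m+a)+2\pi i\,{}^t(m+a)(z+b)}.$$ The choice $a=b=0$ gives the Riemann theta function $\theta(z,\tau)$. The characteristic is called even or odd according to whether $\theta\left[{a\atop b}\right](z,\tau)$ is an even or odd function of $z$ (equivalently $e^{4\pi i\,{}^tab}=1$ or $-1$); there are ten even and six odd ones. $\theta_i=\partial\theta/\partial z_i$ and $\theta_{ij}=\partial^2\theta/\partial z_i\partial z_j$, evaluated at $(z,\tau)$. *)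

theory Defs
  imports "HOL-Analysis.Analysis"
begin

definition siegel_upper_half_space :: "(complex^'n^'n) set" where
  "siegel_upper_half_space =
     {\<tau>. transpose \<tau> = \<tau> \<and>
          (\<forall>x::real^'n. x \<noteq> 0 \<longrightarrow> x \<bullet> ((\<chi> i j. Im (\<tau> $ i $ j)) *v x) > 0)}"

text \<open>The complex bilinear pairing of \<open>u\<close> and \<open>v\<close>, i.e. the product of the transpose of \<open>u\<close>
  with \<open>v\<close>; the library's inner product on \<open>complex^'n\<close> is a real-valued one.\<close>

definition cpair :: "complex^'n \<Rightarrow> complex^'n \<Rightarrow> complex" where
  "cpair u v = (\<Sum>i\<in>UNIV. u $ i * v $ i)"

definition cvec_of_int :: "int^'n \<Rightarrow> complex^'n" where
  "cvec_of_int m = (\<chi> i. of_int (m $ i))"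

text \<open>For \<open>\<tau>\<close> in the Siegel upper half space the family below is absolutely summable, so that
  \<open>infsum\<close> is the genuine sum of the series.\<close>

definition theta_char ::
  "complex^'n \<Rightarrow> complex^'n \<Rightarrow> complex^'n \<Rightarrow> complex^'n^'n \<Rightarrow> complex" where
  "theta_char a b z \<tau> =
     (\<Sum>\<^sub>\<infinity>m\<in>(UNIV :: (int^'n) set).
        let u = cvec_of_int m + a in
        exp (of_real pi * \<i> * cpair u (\<tau> *v u) + 2 * of_real pi * \<i> * cpair u (z + b)))"

definition riemann_theta :: "complex^'n \<Rightarrow> complex^'n^'n \<Rightarrow> complex" where
  "riemann_theta = theta_char 0 0"

definition theta_characteristics :: "((complex^'n) \<times> (complex^'n)) set" where
  "theta_characteristics = {(a, b). \<forall>i. a $ i \<in> {0, 1/2} \<and> b $ i \<in> {0, 1/2}}"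

definition even_theta_characteristics :: "((complex^'n) \<times> (complex^'n)) set" where
  "even_theta_characteristics =
     {(a, b) \<in> theta_characteristics.
        \<forall>\<tau>\<in>siegel_upper_half_space. \<forall>z. theta_char a b (- z) \<tau> = theta_char a b z \<tau>}"

definition partial_deriv :: "'n \<Rightarrow> (complex^'n \<Rightarrow> complex) \<Rightarrow> complex^'n \<Rightarrow> complex" where
  "partial_deriv i f z = deriv (\<lambda>w. f (\<chi> k. if k = i then w else z $ k)) (z $ i)"

definition theta_d1 :: "'n \<Rightarrow> complex^'n \<Rightarrow> complex^'n^'n \<Rightarrow> complex" where
  "theta_d1 i z \<tau> = partial_deriv i (\<lambda>x. riemann_theta x \<tau>) z"

definition theta_d2 :: "'n \<Rightarrow> 'n \<Rightarrow> complex^'n \<Rightarrow> complex^'n^'n \<Rightarrow> complex" where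
  "theta_d2 i j z \<tau> = partial_deriv i (partial_deriv j (\<lambda>x. riemann_theta x \<tau>)) z"

definition eta :: "complex^2 \<Rightarrow> complex^2^2 \<Rightarrow> complex" where
  "eta z \<tau> =
     theta_d2 1 1 z \<tau> * (theta_d1 2 z \<tau>)\<^sup>2
     - 2 * theta_d2 1 2 z \<tau> * theta_d1 1 z \<tau> * theta_d1 2 z \<tau>
     + theta_d2 2 2 z \<tau> * (theta_d1 1 z \<tau>)\<^sup>2"

lemma finite_theta_characteristics:
  "finite (theta_characteristics :: ((complex^'n) \<times> (complex^'n)) set)"
proof -
  let ?V = "{v :: complex^'n. \<forall>i. v $ i \<in> {0, 1/2}}"
  have "finite (PiE (UNIV :: 'n set) (\<lambda>_. {0, 1/2 :: complex}))"
    by (intro finite_PiE) auto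
  moreover have "?V \<subseteq> vec_lambda ` PiE (UNIV :: 'n set) (\<lambda>_. {0, 1/2 :: complex})"
  proof
    fix v assume "v \<in> ?V"
    then show "v \<in> vec_lambda ` PiE (UNIV :: 'n set) (\<lambda>_. {0, 1/2 :: complex})"
      by (intro image_eqI[where x = "vec_nth v"]) auto
  qed
  ultimately have "finite ?V"
    by (meson finite_imageI finite_subset)
  then have "finite (?V \<times> ?V)"
    by blast
  then show ?thesis
    by (rule rev_finite_subset) (auto simp: theta_characteristics_def)
qed

lemma finite_even_theta_characteristics:
  "finite (even_theta_characteristics :: ((complex^'n) \<times> (complex^'n)) set)"
  by (rule finite_subset[OF _ finite_theta_characteristics])
     (auto simp: even_theta_characteristics_def)

end

theory Submission
  imports Defs "HOL-Complex_Analysis.Conformal_Mappings"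
begin

text \<open>
  Write \<open>K(x)\<close> for the vector of the four second order theta functions, so that the addition theorem reads
  \<open>\<theta>(x + y) \<theta>(x - y) = \<langle>K(x), K(y)\<rangle>\<close>. Each of the six odd theta functions \<open>\<theta>\<^sub>j\<close> satisfies
  \<open>\<theta>\<^sub>j(x + y) \<theta>\<^sub>j(x - y) = \<omega>\<^sub>j(K(x), K(y))\<close> with a constant skew form of Pfaffian \<open>\<plusminus>1\<close>. Let \<open>d\<close> be the determinant
  of \<open>K\<close> and its three second derivatives at \<open>0\<close>. If \<open>\<theta>(u) = 0\<close>, the Taylor coefficients of these formulas give the
  pairings of \<open>K(u)\<close>, \<open>\<partial>\<^sub>1K(u)\<close>, \<open>\<partial>\<^sub>2K(u)\<close> and \<open>K(2u)\<close> with that frame, and comparing determinants with Pfaffians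
  yields \<open>d\<^sup>2 \<theta>(3u) = - 64 \<eta>(u)\<^sup>3\<close>.

  It remains to see that \<open>d = - 8 \<pi>\<^sup>6 \<Prod> \<theta>[\<epsilon>](0)\<close>. The duplication formulas for theta functions show that the
  quotient of both sides is unchanged under \<open>\<tau> \<mapsto> 2\<tau>\<close>. On an open set of \<open>\<tau>\<close> it is therefore equal to its limit
  along \<open>2\<^sup>n\<tau>\<close>, which only involves the leading terms of the series; analytic continuation does the rest.
\<close>

section \<open>Theta series with complex parameters\<close>

text \<open>The argument 3u comes from x = 2u, y = u in the addition theorem: then x - y = u, so
  \<open>\<theta>(u) = 0\<close> kills the value and leaves \<open>- \<theta>(3u)\<close> times the
  gradient at u as first derivatives in y. One odd theta function, with value X at 2u and derivative
  h at 0 along the tangent of the theta divisor at u, gives two relations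
  \<open>X d = \<plusminus>8 h \<eta>\<close> and
  \<open>\<theta>(3u) h d = \<plusminus>8 \<eta>^2 X\<close> with opposite signs, and eliminating X
  produces the cube. For a single odd function h may be 0; the six forms together span all 2-forms,
  so for \<open>\<eta> \<noteq> 0\<close> some h is not. Where d or \<open>\<eta>\<close> vanishes
  no division is possible, and these cases get their own arguments instead of a density argument.

  The limit along \<open>2^n \<tau>\<close> needs a single pair of shortest vectors in each nonzero
  half-integral class. A diagonal imaginary part fails: the class of (1/2, 1/2) then has four. This
  is why a hexagonal direction appears. A general \<open>\<tau>\<close> is reached along a complex
  line in that direction, so one-variable continuation suffices. As d enters squared, the final sign
  is that of -64, the same for all z and \<open>\<tau>\<close>.\<close>

definition qform :: "real \<Rightarrow> real \<Rightarrow> real \<Rightarrow> real \<Rightarrow> real \<Rightarrow> real" where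
  "qform p q r u v = p * u\<^sup>2 + 2 * q * u * v + r * v\<^sup>2"

text \<open>The period matrix has diagonal \<open>p\<close>, \<open>r\<close> and off-diagonal entry \<open>q\<close>; \<open>j\<close> and \<open>k\<close> are the orders of
  differentiation with respect to \<open>z\<close> and \<open>w\<close>.\<close>

definition theta_term :: "real \<Rightarrow> real \<Rightarrow> nat \<Rightarrow> nat \<Rightarrow> complex \<Rightarrow> complex \<Rightarrow> complex \<Rightarrow> complex \<Rightarrow> complex \<Rightarrow> int \<times> int \<Rightarrow> complex" where
  "theta_term a b j k p q r z w = (\<lambda>(m, n).
     (2 * of_real pi * \<i> * of_real (of_int m + a)) ^ j * (2 * of_real pi * \<i> * of_real (of_int n + b)) ^ k *
     exp (of_real pi * \<i> * (p * of_real ((of_int m + a)\<^sup>2) + 2 * q * of_real ((of_int m + a) * (of_int n + b)) + r * of_real ((of_int n + b)\<^sup>2))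
          + 2 * of_real pi * \<i> * (of_real (of_int m + a) * z + of_real (of_int n + b) * w)))"

definition theta2 :: "real \<Rightarrow> real \<Rightarrow> nat \<Rightarrow> nat \<Rightarrow> complex \<Rightarrow> complex \<Rightarrow> complex \<Rightarrow> complex \<Rightarrow> complex \<Rightarrow> complex" where
  "theta2 a b j k p q r z w = (\<Sum>\<^sub>\<infinity>mn. theta_term a b j k p q r z w mn)"

text \<open>The share of one coordinate in a bound for the terms, with R bounding z and w. Since the
  bound factors, summability over pairs reduces to one dimension.\<close>

definition theta_majorant :: "real \<Rightarrow> real \<Rightarrow> nat \<Rightarrow> real \<Rightarrow> int \<Rightarrow> real" where
  "theta_majorant c R j a m = (2 * pi * \<bar>of_int m + a\<bar>) ^ j * exp (2 * pi * R * \<bar>of_int m + a\<bar> - pi * c * (of_int m + a)\<^sup>2)"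

lemma norm_theta_term:
  "norm (theta_term a b j k p q r z w (m, n)) =
     (2 * pi * \<bar>of_int m + a\<bar>) ^ j * (2 * pi * \<bar>of_int n + b\<bar>) ^ k *
     exp (- pi * qform (Im p) (Im q) (Im r) (of_int m + a) (of_int n + b)
          - 2 * pi * ((of_int m + a) * Im z + (of_int n + b) * Im w))"
proof -
  have *: "norm (2 * of_real pi * \<i> * of_real x) = 2 * pi * \<bar>x\<bar>" for x
    by (simp add: norm_mult)
  have **: "norm (x ^ j * y ^ k * exp e) = norm x ^ j * norm y ^ k * exp (Re e)" for x y e :: complex
    by (simp add: norm_mult norm_power)
  show ?thesis
    unfolding theta_term_def qform_def prod.case ** *
    by (simp add: algebra_simps power2_eq_square)
qed

lemma summable_exp_abs_int: "(\<lambda>m::int. exp (- \<bar>of_int m :: real\<bar>)) summable_on UNIV"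
proof -
  have s: "(\<lambda>n::nat. exp (- real n)) summable_on UNIV"
  proof -
    have "summable (\<lambda>n. (exp (-1::real)) ^ n)"
      by (rule summable_geometric) simp
    then have "summable (\<lambda>n. exp (- real n))"
      by (simp add: exp_of_nat_mult[symmetric])
    then show ?thesis
      by (intro norm_summable_imp_summable_on) simp
  qed
  have 1: "(\<lambda>m::int. exp (- \<bar>of_int m :: real\<bar>)) summable_on (int ` UNIV)"
    by (subst summable_on_reindex) (use s in \<open>auto simp: o_def\<close>)
  have 2: "(\<lambda>m::int. exp (- \<bar>of_int m :: real\<bar>)) summable_on ((\<lambda>n. - int n) ` UNIV)"
    by (subst summable_on_reindex) (use s in \<open>auto simp: o_def inj_on_def\<close>)
  have "int ` UNIV \<union> (\<lambda>n. - int n) ` UNIV = (UNIV :: int set)"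
  proof (intro equalityI subsetI UNIV_I)
    show "m \<in> int ` UNIV \<union> (\<lambda>n. - int n) ` UNIV" for m :: int
      by (cases m rule: int_cases2) auto
  qed
  then show ?thesis
    using summable_on_union[OF 1 2] by simp
qed

lemma power_le_fact_exp: "0 \<le> x \<Longrightarrow> x ^ j \<le> fact j * exp (x::real)"
proof -
  assume x: "0 \<le> x"
  have "(\<Sum>n\<in>{j}. inverse (fact n) * x ^ n) \<le> (\<Sum>n. inverse (fact n) * x ^ n)"
    using x summable_exp[of x] by (intro sum_le_suminf) auto
  then show ?thesis
    by (simp add: exp_def scaleR_conv_of_real field_simps)
qed

lemma theta_majorant_nonneg: "0 \<le> theta_majorant c R j a m"
  by (simp add: theta_majorant_def)

lemma summable_theta_majorant:
  assumes "c > 0"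
  shows "theta_majorant c R j a summable_on UNIV"
proof -
  \<comment> \<open>The summand \<open>2 * pi\<close> absorbs the power through
    \<open>power_le_fact_exp\<close>, and the summand 1 is spent on the factor exp(-x); the rest is
    completing the square.\<close>
  define B where "B = 2 * pi * R + 2 * pi + 1"
  define C where "C = fact j * exp (B\<^sup>2 / (4 * (pi * c)) + \<bar>a\<bar>)"
  have "theta_majorant c R j a m \<le> C * exp (- \<bar>of_int m\<bar>)" for m
  proof -
    define x where "x = \<bar>of_int m + a\<bar>"
    have x: "x \<ge> 0" by (simp add: x_def)
    have "theta_majorant c R j a m \<le> fact j * exp (2 * pi * x) * exp (2 * pi * R * x - pi * c * x\<^sup>2)"
      unfolding theta_majorant_def x_def[symmetric]
      using power_le_fact_exp[of "2 * pi * x" j] x by (simp add: x_def)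
    also have "\<dots> = fact j * exp ((B * x - pi * c * x\<^sup>2) - x)"
      by (simp add: exp_add[symmetric] B_def algebra_simps)
    also have "\<dots> \<le> fact j * exp ((B\<^sup>2 / (4 * (pi * c)) - x))"
    proof -
      define P where "P = pi * c"
      have P: "P > 0" using assms by (simp add: P_def)
      have "0 \<le> (2 * P * x - B)\<^sup>2 / (4 * P)"
        using P by (intro divide_nonneg_pos) auto
      also have "\<dots> = P * x\<^sup>2 - B * x + B\<^sup>2 / (4 * P)"
        using P by (simp add: power2_eq_square field_simps)
      finally have "B * x - P * x\<^sup>2 - x \<le> B\<^sup>2 / (4 * P) - x" by simp
      then show ?thesis by (simp add: P_def)
    qed
    also have "\<dots> \<le> fact j * exp (B\<^sup>2 / (4 * (pi * c)) + \<bar>a\<bar> - \<bar>of_int m\<bar>)"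
      by (simp add: x_def)
    also have "\<dots> = C * exp (- \<bar>of_int m\<bar>)"
      by (simp add: C_def exp_add[symmetric] exp_diff exp_minus field_simps)
    finally show ?thesis .
  qed
  moreover have "(\<lambda>m. C * exp (- \<bar>of_int m\<bar>)) summable_on (UNIV :: int set)"
    by (intro summable_on_cmult_right summable_exp_abs_int)
  ultimately show ?thesis
    using summable_on_comparison_test[of "\<lambda>m. C * exp (- \<bar>of_int m\<bar>)" UNIV "theta_majorant c R j a"]
    by (simp add: theta_majorant_nonneg)
qed

lemma summable_on_times_real:
  fixes f :: "'a \<Rightarrow> real" and g :: "'b \<Rightarrow> real"
  assumes "f summable_on A" "g summable_on B" "\<And>x. f x \<ge> 0" "\<And>x. g x \<ge> 0"
  shows "(\<lambda>(x, y). f x * g y) summable_on (A \<times> B)"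
proof (rule summable_on_SigmaI[where g = "\<lambda>x. f x * infsum g B"])
  show "((\<lambda>y. (case (x, y) of (x, y) \<Rightarrow> f x * g y)) has_sum f x * infsum g B) B" for x
    using assms(2) by (auto intro!: has_sum_cmult_right)
qed (use assms in \<open>auto intro!: summable_on_cmult_left\<close>)

text \<open>Positive definiteness in quantitative form: one c valid on a set of period matrices
  makes the majorant uniform there, as the M-test requires.\<close>

definition im_ge :: "real \<Rightarrow> complex \<Rightarrow> complex \<Rightarrow> complex \<Rightarrow> bool" where
  "im_ge c p q r \<longleftrightarrow> (\<forall>u v. qform (Im p) (Im q) (Im r) u v \<ge> c * (u\<^sup>2 + v\<^sup>2))"

lemma norm_theta_term_le:
  assumes "im_ge c p q r" "norm z \<le> R" "norm w \<le> R"
  shows "norm (theta_term a b j k p q r z w mn) \<le> (case mn of (m, n) \<Rightarrow> theta_majorant c R j a m * theta_majorant c R k b n)"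
proof (cases mn)
  case (Pair m n)
  define u v where "u = of_int m + a" and "v = of_int n + b"
  define Q where "Q = qform (Im p) (Im q) (Im r) u v"
  have Q: "Q \<ge> c * (u\<^sup>2 + v\<^sup>2)"
    using assms unfolding im_ge_def Q_def by blast
  have lin: "- (x * Im y) \<le> R * \<bar>x\<bar>" if "norm y \<le> R" for x y
  proof -
    have "- (x * Im y) \<le> \<bar>x\<bar> * \<bar>Im y\<bar>"
      by (metis abs_ge_minus_self abs_mult)
    also have "\<dots> \<le> \<bar>x\<bar> * R"
      using abs_Im_le_cmod[of y] that by (intro mult_left_mono) linarith+
    finally show ?thesis by (simp add: mult.commute)
  qed
  have "- Q - 2 * (u * Im z + v * Im w) \<le> (2 * (R * \<bar>u\<bar>) - c * u\<^sup>2) + (2 * (R * \<bar>v\<bar>) - c * v\<^sup>2)"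
    using Q lin[OF assms(2), of u] lin[OF assms(3), of v] unfolding distrib_left by linarith
  then have "pi * (- Q - 2 * (u * Im z + v * Im w)) \<le> pi * ((2 * (R * \<bar>u\<bar>) - c * u\<^sup>2) + (2 * (R * \<bar>v\<bar>) - c * v\<^sup>2))"
    by (rule mult_left_mono) simp
  then have A: "- pi * Q - 2 * pi * (u * Im z + v * Im w)
      \<le> (2 * pi * R * \<bar>u\<bar> - pi * c * u\<^sup>2) + (2 * pi * R * \<bar>v\<bar> - pi * c * v\<^sup>2)" (is "?e \<le> ?e1 + ?e2")
    by (simp only: ring_distribs mult_ac mult_minus_left mult_minus_right)
  have "(2 * pi * \<bar>u\<bar>) ^ j * (2 * pi * \<bar>v\<bar>) ^ k * exp ?e \<le> (2 * pi * \<bar>u\<bar>) ^ j * (2 * pi * \<bar>v\<bar>) ^ k * exp (?e1 + ?e2)"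
    by (rule mult_left_mono) (use A in simp_all)
  also have "\<dots> = ((2 * pi * \<bar>u\<bar>) ^ j * exp ?e1) * ((2 * pi * \<bar>v\<bar>) ^ k * exp ?e2)"
    by (simp only: exp_add mult_ac)
  finally show ?thesis
    unfolding Pair norm_theta_term prod.case theta_majorant_def u_def[symmetric] v_def[symmetric] Q_def .
qed

lemma summable_theta_majorant2:
  assumes "c > 0"
  shows "(\<lambda>(m, n). theta_majorant c R j a m * theta_majorant c R k b n) summable_on UNIV"
  using summable_on_times_real[OF summable_theta_majorant[OF assms] summable_theta_majorant[OF assms]]
  by (simp add: theta_majorant_nonneg)

lemma abs_summable_theta_term:
  assumes "im_ge c p q r" "c > 0"
  shows "(\<lambda>mn. norm (theta_term a b j k p q r z w mn)) summable_on UNIV"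
  by (rule Infinite_Sum.abs_summable_on_comparison_test'[OF summable_theta_majorant2[OF assms(2)]])
     (rule norm_theta_term_le[OF assms(1), where R = "max (norm z) (norm w)"], auto)

lemma summable_theta_term:
  assumes "im_ge c p q r" "c > 0"
  shows "theta_term a b j k p q r z w summable_on UNIV"
  using abs_summable_theta_term[OF assms] by (rule Infinite_Sum.abs_summable_summable)

text \<open>The M-test gives uniform convergence of the finite partial sums on a closed disc, and
  for holomorphic functions this forces convergence of the derivatives inside it.\<close>

lemma has_field_derivative_infsum:
  fixes f :: "'a \<Rightarrow> complex \<Rightarrow> complex"
  assumes S: "open S" "s \<in> S"
    and der: "\<And>x s. s \<in> S \<Longrightarrow> (f x has_field_derivative f' x s) (at s)"
    and bd: "\<And>x s. s \<in> S \<Longrightarrow> norm (f x s) \<le> M x"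
    and M: "M summable_on X"
  shows "((\<lambda>s. \<Sum>\<^sub>\<infinity>x\<in>X. f x s) has_field_derivative (\<Sum>\<^sub>\<infinity>x\<in>X. f' x s)) (at s)"
proof -
  obtain d where d: "d > 0" "cball s d \<subseteq> S"
    using S open_contains_cball by blast
  have ul: "uniform_limit (cball s d) (\<lambda>F y. \<Sum>x\<in>F. f x y) (\<lambda>y. \<Sum>\<^sub>\<infinity>x\<in>X. f x y) (finite_subsets_at_top X)"
    using d bd by (intro Weierstrass_m_test_general[OF _ M]) auto
  have cont: "continuous_on (cball s d) (f x)" for x
    using der d by (intro DERIV_continuous_on[of _ _ "f' x"]) (meson has_field_derivative_at_within subsetD)
  obtain g' where g: "\<And>w. w \<in> ball s d \<Longrightarrow> ((\<lambda>y. \<Sum>\<^sub>\<infinity>x\<in>X. f x y) has_field_derivative g' w) (at w)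
      \<and> ((\<lambda>F. \<Sum>x\<in>F. f' x w) \<longlongrightarrow> g' w) (finite_subsets_at_top X)"
  proof (rule has_complex_derivative_uniform_limit[OF _ ul _ d(1), of "\<lambda>F w. \<Sum>x\<in>F. f' x w"])
    show "\<forall>\<^sub>F n in finite_subsets_at_top X. continuous_on (cball s d) (\<lambda>y. \<Sum>x\<in>n. f x y) \<and>
       (\<forall>w\<in>ball s d. ((\<lambda>y. \<Sum>x\<in>n. f x y) has_field_derivative (\<Sum>x\<in>n. f' x w)) (at w))"
      using d by (intro always_eventually allI conjI continuous_on_sum cont ballI DERIV_sum der) auto
  qed (auto simp: finite_subsets_at_top_neq_bot)
  from g[of s] d have "((\<lambda>F. \<Sum>x\<in>F. f' x s) \<longlongrightarrow> g' s) (finite_subsets_at_top X)"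
    and D: "((\<lambda>y. \<Sum>\<^sub>\<infinity>x\<in>X. f x y) has_field_derivative g' s) (at s)" by auto
  then have "(\<Sum>\<^sub>\<infinity>x\<in>X. f' x s) = g' s"
    by (intro infsumI) (simp add: has_sum_def)
  with D show ?thesis by simp
qed

section \<open>Termwise derivatives of the theta series\<close>

lemma theta_term_deriv1:
  "((\<lambda>z. theta_term a b j k p q r z w mn) has_field_derivative theta_term a b (Suc j) k p q r z w mn) (at z)"
proof -
  have *: "((\<lambda>z. A * exp (B + 2 * of_real pi * \<i> * (u * z + v))) has_field_derivative
         A * (exp (B + 2 * of_real pi * \<i> * (u * z + v)) * (2 * of_real pi * \<i> * u))) (at z)" for A B u v :: complex
    by (auto intro!: derivative_eq_intros)
  show ?thesis
    unfolding theta_term_def case_prod_beta power_Suc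
    by (rule DERIV_cong[OF *]) (simp only: mult_ac)
qed

lemma theta_term_deriv2:
  "((\<lambda>w. theta_term a b j k p q r z w mn) has_field_derivative theta_term a b j (Suc k) p q r z w mn) (at w)"
proof -
  have *: "((\<lambda>w. A * exp (B + 2 * of_real pi * \<i> * (u + v * w))) has_field_derivative
         A * (exp (B + 2 * of_real pi * \<i> * (u + v * w)) * (2 * of_real pi * \<i> * v))) (at w)" for A B u v :: complex
    by (auto intro!: derivative_eq_intros)
  show ?thesis
    unfolding theta_term_def case_prod_beta power_Suc
    by (rule DERIV_cong[OF *]) (simp only: mult_ac)
qed

lemma theta2_deriv1:
  assumes pd: "im_ge c p q r" "c > 0"
  shows "((\<lambda>z. theta2 a b j k p q r z w) has_field_derivative theta2 a b (Suc j) k p q r z w) (at z)"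
  unfolding theta2_def
proof (rule has_field_derivative_infsum[where S = "ball z 1"])
  fix mn z' assume z': "z' \<in> ball z 1"
  have "norm z' \<le> norm z + 1"
    using z' norm_triangle_ineq2[of z' z] by (auto simp: dist_norm norm_minus_commute)
  then show "norm (theta_term a b j k p q r z' w mn) \<le>
      (case mn of (m, n) \<Rightarrow> theta_majorant c (norm z + norm w + 1) j a m * theta_majorant c (norm z + norm w + 1) k b n)"
    by (intro norm_theta_term_le pd) (use norm_ge_zero[of w] norm_ge_zero[of z] in linarith)+
  show "((\<lambda>z. theta_term a b j k p q r z w mn) has_field_derivative theta_term a b (Suc j) k p q r z' w mn) (at z')"
    by (rule theta_term_deriv1)
qed (use summable_theta_majorant2[OF pd(2)] in auto)

lemma theta2_deriv2:
  assumes pd: "im_ge c p q r" "c > 0"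
  shows "((\<lambda>w. theta2 a b j k p q r z w) has_field_derivative theta2 a b j (Suc k) p q r z w) (at w)"
  unfolding theta2_def
proof (rule has_field_derivative_infsum[where S = "ball w 1"])
  fix mn w' assume z': "w' \<in> ball w 1"
  have "norm w' \<le> norm w + 1"
    using z' norm_triangle_ineq2[of w' w] by (auto simp: dist_norm norm_minus_commute)
  then show "norm (theta_term a b j k p q r z w' mn) \<le>
      (case mn of (m, n) \<Rightarrow> theta_majorant c (norm z + norm w + 1) j a m * theta_majorant c (norm z + norm w + 1) k b n)"
    by (intro norm_theta_term_le pd) (use norm_ge_zero[of w] norm_ge_zero[of z] in linarith)+
  show "((\<lambda>w. theta_term a b j k p q r z w mn) has_field_derivative theta_term a b j (Suc k) p q r z w' mn) (at w')"
    by (rule theta_term_deriv2)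
qed (use summable_theta_majorant2[OF pd(2)] in auto)

text \<open>All five arguments move with one complex parameter. This covers lines in (z, w) at a
  fixed period matrix as well as lines of period matrices.\<close>

lemma theta2_holomorphic:
  assumes S: "open S" and c: "c > 0"
    and hol: "p holomorphic_on S" "q holomorphic_on S" "r holomorphic_on S" "z holomorphic_on S" "w holomorphic_on S"
    and pd: "\<And>s. s \<in> S \<Longrightarrow> im_ge c (p s) (q s) (r s)"
    and bd: "\<And>s. s \<in> S \<Longrightarrow> norm (z s) \<le> R" "\<And>s. s \<in> S \<Longrightarrow> norm (w s) \<le> R"
  shows "(\<lambda>s. theta2 a b j k (p s) (q s) (r s) (z s) (w s)) holomorphic_on S"
proof -
  define f where "f = (\<lambda>mn s. theta_term a b j k (p s) (q s) (r s) (z s) (w s) mn)"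
  have f: "f mn holomorphic_on S" for mn
    unfolding f_def theta_term_def case_prod_beta by (intro holomorphic_intros hol)
  have "((\<lambda>s. \<Sum>\<^sub>\<infinity>mn. f mn s) has_field_derivative (\<Sum>\<^sub>\<infinity>mn. deriv (f mn) s)) (at s)" if "s \<in> S" for s
  proof (rule has_field_derivative_infsum[OF S that])
    show "(f x has_field_derivative deriv (f x) s) (at s)" if "s \<in> S" for x s
      by (rule holomorphic_derivI[OF f S that])
    show "norm (f x s) \<le> (case x of (m, n) \<Rightarrow> theta_majorant c R j a m * theta_majorant c R k b n)" if "s \<in> S" for x s
      unfolding f_def by (rule norm_theta_term_le[OF pd[OF that] bd(1)[OF that] bd(2)[OF that]])
  qed (rule summable_theta_majorant2[OF c])
  then show ?thesis
    unfolding theta2_def f_def by (subst holomorphic_on_open[OF S], intro ballI exI)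
qed

section \<open>Translations and the addition theorem\<close>

lemma theta2_shift1: "theta2 (a + 1) b j k p q r z w = theta2 a b j k p q r z w"
  unfolding theta2_def
  by (rule infsum_reindex_bij_witness[where i = "\<lambda>(m, n). (m - 1, n)" and j = "\<lambda>(m, n). (m + 1, n)"])
     (auto simp: theta_term_def add.assoc add.commute[of 1])

lemma theta2_shift2: "theta2 a (b + 1) j k p q r z w = theta2 a b j k p q r z w"
  unfolding theta2_def
  by (rule infsum_reindex_bij_witness[where i = "\<lambda>(m, n). (m, n - 1)" and j = "\<lambda>(m, n). (m, n + 1)"])
     (auto simp: theta_term_def add.assoc add.commute[of 1])

lemma theta2_one [simp]: "theta2 1 b j k p q r z w = theta2 0 b j k p q r z w" "theta2 a 1 j k p q r z w = theta2 a 0 j k p q r z w"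
  using theta2_shift1[of 0 b] theta2_shift2[of a 0] by simp_all

lemma theta2_period1: "theta2 a b j k p q r (z + 1) w = exp (2 * of_real pi * \<i> * of_real a) * theta2 a b j k p q r z w"
proof -
  have "theta_term a b j k p q r (z + 1) w mn = exp (2 * of_real pi * \<i> * of_real a) * theta_term a b j k p q r z w mn" for mn
  proof (cases mn)
    case (Pair m n)
    have "exp (2 * of_real pi * \<i> * of_int m) = 1"
      using exp_integer_2pi[OF Ints_of_int, of m] by (simp add: mult_ac)
    then have *: "exp (e + 2 * of_real pi * \<i> * (of_real (of_int m + a) * (z + 1) + v)) =
        exp (2 * of_real pi * \<i> * of_real a) * exp (e + 2 * of_real pi * \<i> * (of_real (of_int m + a) * z + v))" for e v
      by (simp add: exp_add ring_distribs)
    show ?thesis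
      unfolding Pair theta_term_def prod.case * by (simp only: mult_ac)
  qed
  then show ?thesis
    by (simp add: theta2_def infsum_cmult_right')
qed

lemma theta2_period2: "theta2 a b j k p q r z (w + 1) = exp (2 * of_real pi * \<i> * of_real b) * theta2 a b j k p q r z w"
proof -
  have "theta_term a b j k p q r z (w + 1) mn = exp (2 * of_real pi * \<i> * of_real b) * theta_term a b j k p q r z w mn" for mn
  proof (cases mn)
    case (Pair m n)
    have "exp (2 * of_real pi * \<i> * of_int n) = 1"
      using exp_integer_2pi[OF Ints_of_int, of n] by (simp add: mult_ac)
    then have *: "exp (e + 2 * of_real pi * \<i> * (v + of_real (of_int n + b) * (w + 1))) =
        exp (2 * of_real pi * \<i> * of_real b) * exp (e + 2 * of_real pi * \<i> * (v + of_real (of_int n + b) * w))" for e v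
      by (simp add: exp_add ring_distribs)
    show ?thesis
      unfolding Pair theta_term_def prod.case * by (simp only: mult_ac)
  qed
  then show ?thesis
    by (simp add: theta2_def infsum_cmult_right')
qed

text \<open>The substitution m -> -m - 2a, n -> -n - 2b reflects the coset of summation vectors into
  itself; the sign comes from the derivative factors.\<close>

lemma theta2_uminus:
  assumes "2 * a \<in> \<int>" "2 * b \<in> \<int>"
  shows "theta2 a b j k p q r (- z) (- w) = (-1) ^ (j + k) * theta2 a b j k p q r z w"
proof -
  obtain A B :: int where A: "2 * a = of_int A" and B: "2 * b = of_int B"
    using assms by (auto elim!: Ints_cases)
  have *: "theta_term a b j k p q r (- z) (- w) (- m - A, - n - B) = (-1) ^ (j + k) * theta_term a b j k p q r z w (m, n)" for m n
  proof -
    define U V where "U = of_int m + a" and "V = of_int n + b"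
    have uv: "of_int (- m - A) + a = - U" "of_int (- n - B) + b = - V"
      using A B by (simp_all add: U_def V_def)
    have e: "2 * of_real pi * \<i> * of_real (- x) = - (2 * of_real pi * \<i> * of_real x)"
       "of_real (- x) * (- y) = of_real x * y" "(- x)\<^sup>2 = x\<^sup>2" "(- x) * (- x') = x * x'" for x x' :: real and y :: complex
      by simp_all
    have f: "(- x) ^ j * (- y) ^ k = (-1) ^ (j + k) * (x ^ j * y ^ k)" for x y :: complex
      by (simp add: power_minus[of x] power_minus[of y] power_add)
    show ?thesis
      unfolding theta_term_def prod.case uv e f unfolding U_def V_def by (rule mult.assoc)
  qed
  have "theta2 a b j k p q r (- z) (- w) = (\<Sum>\<^sub>\<infinity>mn. (-1) ^ (j + k) * theta_term a b j k p q r z w mn)"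
    unfolding theta2_def
    by (rule infsum_reindex_bij_witness[where i = "\<lambda>(m, n). (- m - A, - n - B)" and j = "\<lambda>(m, n). (- m - A, - n - B)"])
       (auto simp: *[symmetric] simp del: minus_diff_eq)
  then show ?thesis
    by (simp add: theta2_def infsum_cmult_right')
qed

lemma infsum_times_complex:
  fixes f :: "'a \<Rightarrow> complex" and g :: "'b \<Rightarrow> complex"
  assumes "(\<lambda>x. norm (f x)) summable_on UNIV" "(\<lambda>x. norm (g x)) summable_on UNIV"
  shows "(\<lambda>(x, y). f x * g y) summable_on UNIV"
    "infsum f UNIV * infsum g UNIV = infsum (\<lambda>(x, y). f x * g y) UNIV"
proof -
  have "(\<lambda>(x, y). norm (f x) * norm (g y)) summable_on (UNIV \<times> UNIV)"
    by (rule summable_on_times_real) (use assms in auto)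
  then have s: "(\<lambda>(x, y). f x * g y) summable_on UNIV \<times> UNIV"
    using Infinite_Sum.abs_summable_summable[of "\<lambda>(x, y). f x * g y" "UNIV \<times> UNIV"]
    by (simp add: case_prod_unfold norm_mult)
  then show "(\<lambda>(x, y). f x * g y) summable_on UNIV" by simp
  show "infsum f UNIV * infsum g UNIV = infsum (\<lambda>(x, y). f x * g y) UNIV"
    using infsum_Sigma'_banach[OF s]
    by (simp add: infsum_cmult_right' infsum_cmult_left')
qed

text \<open>The parallelogram law Q(U + V) + Q(U - V) = 2 Q(U) + 2 Q(V) on the exponents.\<close>

lemma theta_term_mult:
  fixes s t m1 m2 n1 n2 :: int
  shows "theta_term a b 0 0 p q r (x1 + y1) (x2 + y2) (m1 + n1 + s, m2 + n2 + t) *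
     theta_term a b 0 0 p q r (x1 - y1) (x2 - y2) (m1 - n1, m2 - n2) =
     theta_term (a + of_int s / 2) (b + of_int t / 2) 0 0 (2 * p) (2 * q) (2 * r) (2 * x1) (2 * x2) (m1, m2) *
     theta_term (of_int s / 2) (of_int t / 2) 0 0 (2 * p) (2 * q) (2 * r) (2 * y1) (2 * y2) (n1, n2)"
proof -
  define U1 V1 U2 V2 :: real where "U1 = of_int m1 + (a + of_int s / 2)" and "V1 = of_int n1 + of_int s / 2"
    and "U2 = of_int m2 + (b + of_int t / 2)" and "V2 = of_int n2 + of_int t / 2"
  have e: "of_int (m1 + n1 + s) + a = U1 + V1" "of_int (m2 + n2 + t) + b = U2 + V2"
    "of_int (m1 - n1) + a = U1 - V1" "of_int (m2 - n2) + b = U2 - V2"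
    by (simp_all add: U1_def V1_def U2_def V2_def)
  show ?thesis
    unfolding theta_term_def prod.case e U1_def[symmetric] U2_def[symmetric] V1_def[symmetric] V2_def[symmetric]
      power_0 mult_1 exp_add[symmetric]
    by (rule arg_cong[where f = exp]) (simp, algebra)
qed

text \<open>The pairs (M, N) of lattice vectors in the double series are sorted by the parity (s, t)
  of M - N. On one class M = m + n + (s, t) and N = m - n with m and n arbitrary, and
  \<open>theta_term_mult\<close> separates them.\<close>

lemma theta2_add:
  assumes pd: "im_ge c p q r" "c > 0"
  shows "theta2 a b 0 0 p q r (x1 + y1) (x2 + y2) * theta2 a b 0 0 p q r (x1 - y1) (x2 - y2) =
    (\<Sum>(s, t)\<in>{0, 1} \<times> {0, 1::int}.
       theta2 (a + of_int s / 2) (b + of_int t / 2) 0 0 (2 * p) (2 * q) (2 * r) (2 * x1) (2 * x2) *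
       theta2 (of_int s / 2) (of_int t / 2) 0 0 (2 * p) (2 * q) (2 * r) (2 * y1) (2 * y2))"
proof -
  have im_ge2: "im_ge (2 * c) (2 * p) (2 * q) (2 * r)"
    unfolding im_ge_def
  proof (intro allI)
    fix u v
    have "c * (u\<^sup>2 + v\<^sup>2) \<le> qform (Im p) (Im q) (Im r) u v"
      using pd by (simp add: im_ge_def)
    then show "2 * c * (u\<^sup>2 + v\<^sup>2) \<le> qform (Im (2 * p)) (Im (2 * q)) (Im (2 * r)) u v"
      by (simp add: qform_def algebra_simps)
  qed
  define f where "f = theta_term a b 0 0 p q r (x1 + y1) (x2 + y2)"
  define g where "g = theta_term a b 0 0 p q r (x1 - y1) (x2 - y2)"
  define F where "F = (\<lambda>s t. theta_term (a + of_int s / 2) (b + of_int t / 2) 0 0 (2 * p) (2 * q) (2 * r) (2 * x1) (2 * x2))"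
  define G where "G = (\<lambda>s t. theta_term (of_int s / 2) (of_int t / 2) 0 0 (2 * p) (2 * q) (2 * r) (2 * y1) (2 * y2))"
  define S where "S = ({0, 1::int} \<times> {0, 1::int})"
  define H where "H = (\<lambda>((s, t), (m, n)). F s t m * G s t n)"
  define i where "i = (\<lambda>((s, t), ((m1, m2), (n1, n2))). ((m1 + n1 + s :: int, m2 + n2 + t :: int), (m1 - n1, m2 - n2)))"
  define j where "j = (\<lambda>((m1 :: int, m2 :: int), (n1, n2)). (((m1 - n1) mod 2, (m2 - n2) mod 2),
     ((n1 + (m1 - n1) div 2, n2 + (m2 - n2) div 2), ((m1 - n1) div 2, (m2 - n2) div 2 :: int))))"
  have parity: "x = 2 * (x div 2) + x mod 2" for x :: int by simp
  have bij: "i (j x) = x" "j x \<in> S \<times> UNIV" for x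
  proof -
    obtain m1 m2 n1 n2 where x: "x = ((m1, m2), (n1, n2))" by (metis surj_pair)
    show "i (j x) = x"
      using parity[of "m1 - n1"] parity[of "m2 - n2"] by (simp add: x i_def j_def)
    show "j x \<in> S \<times> UNIV"
      by (simp add: x j_def S_def) presburger
  qed
  have bij2: "j (i y) = y" if "y \<in> S \<times> UNIV" for y
  proof -
    obtain s t m1 m2 n1 n2 where y: "y = ((s, t), ((m1, m2), (n1, n2)))" by (metis surj_pair)
    have st: "s \<in> {0, 1}" "t \<in> {0, 1}" using that by (auto simp: y S_def)
    have "m1 + n1 + s - (m1 - n1) = s + 2 * n1" "m2 + n2 + t - (m2 - n2) = t + 2 * n2" by simp_all
    then show ?thesis using st by (auto simp: y i_def j_def)
  qed
  have val: "H (j x) = (case x of (m, n) \<Rightarrow> f m * g n)" for x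
  proof -
    have "H y = (case i y of (m, n) \<Rightarrow> f m * g n)" for y
      by (simp add: H_def i_def f_def g_def F_def G_def theta_term_mult case_prod_beta)
    from this[of "j x"] show ?thesis by (simp add: bij)
  qed
  have fg: "(\<lambda>m. norm (f m)) summable_on UNIV" "(\<lambda>m. norm (g m)) summable_on UNIV"
    unfolding f_def g_def using pd by (auto intro: abs_summable_theta_term)
  have FG: "(\<lambda>m. norm (F s t m)) summable_on UNIV" "(\<lambda>m. norm (G s t m)) summable_on UNIV" for s t
    unfolding F_def G_def using pd im_ge2 by (auto intro: abs_summable_theta_term)
  have "(\<lambda>(x, y). f x * g y) summable_on UNIV \<longleftrightarrow> H summable_on (S \<times> UNIV)"
    by (rule summable_on_reindex_bij_witness[where i = i and j = j]) (use bij bij2 val in auto)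
  then have sumH: "H summable_on (S \<times> UNIV)"
    using infsum_times_complex(1)[OF fg] by simp
  have "infsum f UNIV * infsum g UNIV = infsum (\<lambda>(x, y). f x * g y) UNIV"
    by (rule infsum_times_complex(2)[OF fg])
  also have "\<dots> = infsum H (S \<times> UNIV)"
    by (rule infsum_reindex_bij_witness[where i = i and j = j]) (use bij bij2 val in auto)
  also have "\<dots> = infsum (\<lambda>x. infsum (\<lambda>y. H (x, y)) UNIV) S"
    by (rule infsum_Sigma_banach[OF sumH, symmetric])
  also have "\<dots> = (\<Sum>x\<in>S. infsum (\<lambda>y. H (x, y)) UNIV)"
    by (simp add: S_def)
  also have "\<dots> = (\<Sum>(s, t)\<in>S. infsum (F s t) UNIV * infsum (G s t) UNIV)"
    by (intro sum.cong refl) (auto simp: H_def infsum_times_complex(2)[OF FG])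
  finally show ?thesis
    unfolding f_def g_def F_def G_def S_def theta2_def .
qed

text \<open>Lattice vectors are sorted by parity. A vector of given parity is twice a vector in a
  half-integral class, hence the factor 4 on the quadratic form and 2 on the linear one.\<close>

lemma theta2_parity:
  assumes pd: "im_ge c p q r" "c > 0"
  shows "theta2 0 0 0 0 p q r z w =
    (\<Sum>(s, t)\<in>{0, 1} \<times> {0, 1::int}. theta2 (of_int s / 2) (of_int t / 2) 0 0 (4 * p) (4 * q) (4 * r) (2 * z) (2 * w))"
proof -
  define S where "S = ({0, 1::int} \<times> {0, 1::int})"
  define f where "f = theta_term 0 0 0 0 p q r z w"
  define H where "H = (\<lambda>((s, t), m). theta_term (of_int s / 2) (of_int t / 2) 0 0 (4 * p) (4 * q) (4 * r) (2 * z) (2 * w) m)"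
  define i where "i = (\<lambda>((s, t), (m, n)). (2 * m + s :: int, 2 * n + t :: int))"
  define j where "j = (\<lambda>(m, n). ((m mod 2 :: int, n mod 2), (m div 2 :: int, n div 2 :: int)))"
  have bij: "i (j x) = x" "j x \<in> S \<times> UNIV" for x
    by (simp_all add: i_def j_def S_def case_prod_unfold) presburger
  have bij2: "j (i y) = y" if "y \<in> S \<times> UNIV" for y
    using that by (auto simp: i_def j_def S_def)
  have val: "H (j x) = f x" for x
  proof -
    have "H ((s, t), (m, n)) = f (i ((s, t), (m, n)))" for s t m n
    proof -
      define u v :: real where "u = of_int m + of_int s / 2" and "v = of_int n + of_int t / 2"
      have "of_int (2 * m + s) + 0 = 2 * u" "of_int (2 * n + t) + 0 = 2 * v"
        by (simp_all add: u_def v_def)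
      then show ?thesis
        unfolding H_def f_def i_def prod.case theta_term_def u_def[symmetric] v_def[symmetric]
        by (simp add: power_mult_distrib algebra_simps)
    qed
    then have "H y = f (i y)" for y by (metis surj_pair)
    from this[of "j x"] show ?thesis by (simp add: bij)
  qed
  have "f summable_on UNIV \<longleftrightarrow> H summable_on (S \<times> UNIV)"
    by (rule summable_on_reindex_bij_witness[where i = i and j = j]) (use bij bij2 val in auto)
  then have sumH: "H summable_on (S \<times> UNIV)"
    using summable_theta_term[OF pd] by (simp add: f_def)
  have "infsum f UNIV = infsum H (S \<times> UNIV)"
    by (rule infsum_reindex_bij_witness[where i = i and j = j]) (use bij bij2 val in auto)
  also have "\<dots> = infsum (\<lambda>x. infsum (\<lambda>y. H (x, y)) UNIV) S"
    by (rule infsum_Sigma_banach[OF sumH, symmetric])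
  also have "\<dots> = (\<Sum>x\<in>S. infsum (\<lambda>y. H (x, y)) UNIV)"
    by (simp add: S_def)
  finally show ?thesis
    unfolding f_def H_def S_def theta2_def by (simp add: case_prod_beta)
qed

section \<open>Linear algebra in four dimensions\<close>

definition dot4 :: "(nat \<Rightarrow> complex) \<Rightarrow> (nat \<Rightarrow> complex) \<Rightarrow> complex" where
  "dot4 x y = x 0 * y 0 + x 1 * y 1 + x 2 * y 2 + x 3 * y 3"

definition minor4 :: "(nat \<Rightarrow> complex) \<Rightarrow> (nat \<Rightarrow> complex) \<Rightarrow> nat \<Rightarrow> nat \<Rightarrow> complex" where
  "minor4 x y i j = x i * y j - x j * y i"

text \<open>Laplace expansion along the first two rows: in terms of 2 by 2 minors the determinant
  can be compared directly with skew forms.\<close>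

definition det4 :: "(nat \<Rightarrow> complex) \<Rightarrow> (nat \<Rightarrow> complex) \<Rightarrow> (nat \<Rightarrow> complex) \<Rightarrow> (nat \<Rightarrow> complex) \<Rightarrow> complex" where
  "det4 x y z w = minor4 x y 0 1 * minor4 z w 2 3 - minor4 x y 0 2 * minor4 z w 1 3 + minor4 x y 0 3 * minor4 z w 1 2
     + minor4 x y 1 2 * minor4 z w 0 3 - minor4 x y 1 3 * minor4 z w 0 2 + minor4 x y 2 3 * minor4 z w 0 1"

lemma det_4:
  fixes A :: "'a::comm_ring_1^4^4"
  shows "det A =
    (A$1$1 * A$2$2 - A$1$2 * A$2$1) * (A$3$3 * A$4$4 - A$3$4 * A$4$3)
    - (A$1$1 * A$2$3 - A$1$3 * A$2$1) * (A$3$2 * A$4$4 - A$3$4 * A$4$2)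
    + (A$1$1 * A$2$4 - A$1$4 * A$2$1) * (A$3$2 * A$4$3 - A$3$3 * A$4$2)
    + (A$1$2 * A$2$3 - A$1$3 * A$2$2) * (A$3$1 * A$4$4 - A$3$4 * A$4$1)
    - (A$1$2 * A$2$4 - A$1$4 * A$2$2) * (A$3$1 * A$4$3 - A$3$3 * A$4$1)
    + (A$1$3 * A$2$4 - A$1$4 * A$2$3) * (A$3$1 * A$4$2 - A$3$2 * A$4$1)"
proof -
  have f: "finite {2::4, 3, 4}" "1 \<notin> {2::4, 3, 4}" "finite {3::4, 4}" "2 \<notin> {3::4, 4}" "finite {4::4}" "3 \<notin> {4::4}"
    by auto
  show ?thesis
    unfolding det_def UNIV_4
    unfolding sum_over_permutations_insert[OF f(1,2)]
    unfolding sum_over_permutations_insert[OF f(3,4)]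
    unfolding sum_over_permutations_insert[OF f(5,6)]
    unfolding permutes_sing
    by (simp add: sign_swap_id permutation_swap_id permutation_compose sign_compose sign_id swap_id_eq algebra_simps)
qed

lemma det4_mult:
  "det4 (\<lambda>i. dot4 x (m i)) (\<lambda>i. dot4 y (m i)) (\<lambda>i. dot4 z (m i)) (\<lambda>i. dot4 w (m i)) =
     det4 x y z w * det4 (m 0) (m 1) (m 2) (m 3)"
proof -
  define ix :: "4 \<Rightarrow> nat" where "ix = (\<lambda>i. if i = 1 then 0 else if i = 2 then 1 else if i = 3 then 2 else 3)"
  have ix [simp]: "ix 1 = 0" "ix 2 = 1" "ix 3 = 2" "ix 4 = 3" by (auto simp: ix_def)
  define f where "f = (\<lambda>i. if i = 0 then x else if i = 1 then y else if i = (2::nat) then z else w)"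
  define A :: "complex^4^4" where "A = (\<chi> i j. f (ix i) (ix j))"
  define B :: "complex^4^4" where "B = (\<chi> i j. m (ix j) (ix i))"
  have 1: "det A = det4 x y z w" "det (transpose B) = det4 (m 0) (m 1) (m 2) (m 3)"
    unfolding det_4 by (simp_all add: A_def B_def transpose_def det4_def minor4_def f_def)
  have 2: "det (A ** B) = det4 (\<lambda>i. dot4 x (m i)) (\<lambda>i. dot4 y (m i)) (\<lambda>i. dot4 z (m i)) (\<lambda>i. dot4 w (m i))"
    unfolding det_4 by (simp add: A_def B_def det4_def minor4_def f_def matrix_matrix_mult_def sum_4 dot4_def)
  show ?thesis
    using 1 2 by (simp add: det_mul det_transpose)
qed

text \<open>For \<open>e = \<plusminus>1\<close> these are the skew forms attached to the six odd characteristics. They are written as sums of two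
  complementary minors, so that their common vanishing on a pair of vectors forces all minors to vanish.\<close>

definition skew4 :: "nat \<Rightarrow> complex \<Rightarrow> (nat \<Rightarrow> complex) \<Rightarrow> (nat \<Rightarrow> complex) \<Rightarrow> complex" where
  "skew4 k e x y = (if k = 1 then minor4 x y 0 1 + e * minor4 x y 2 3 else if k = 2 then minor4 x y 0 2 + e * minor4 x y 1 3
     else minor4 x y 0 3 + e * minor4 x y 1 2)"

text \<open>The matrix J of the skew form applied to y. J squares to -1 when e squares to 1, so
  inserting J y into the form gives back \<open>dot4\<close> up to sign.\<close>

definition skew4_vec :: "nat \<Rightarrow> complex \<Rightarrow> (nat \<Rightarrow> complex) \<Rightarrow> nat \<Rightarrow> complex" where
  "skew4_vec k e y i = (if k = 1 then (if i = 0 then y 1 else if i = 1 then - y 0 else if i = 2 then e * y 3 else - e * y 2)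
     else if k = 2 then (if i = 0 then y 2 else if i = 1 then e * y 3 else if i = 2 then - y 0 else - e * y 1)
     else (if i = 0 then y 3 else if i = 1 then e * y 2 else if i = 2 then - e * y 1 else - y 0))"

definition pfaffian4 :: "nat \<Rightarrow> complex \<Rightarrow> complex" where "pfaffian4 k e = (if k = 2 then - e else e)"

lemma skew4_dot: "skew4 k e x y = dot4 x (skew4_vec k e y)"
  by (simp add: skew4_def skew4_vec_def dot4_def minor4_def algebra_simps)

lemma skew4_skew: "skew4 k e x y = - skew4 k e y x"
  by (simp add: skew4_def minor4_def algebra_simps)

lemma skew4_vec_twice: "e * e = 1 \<Longrightarrow> dot4 x (skew4_vec k e (skew4_vec k e y)) = - dot4 x y"
  by (simp add: skew4_vec_def dot4_def algebra_simps flip: mult.assoc)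

text \<open>In dimension four the wedge square of a skew form is twice its Pfaffian times the volume
  form; this is that identity evaluated at four vectors.\<close>

lemma skew4_det4: "e * e = 1 \<Longrightarrow> pfaffian4 k e * det4 a b c d = skew4 k e a b * skew4 k e c d - skew4 k e a c * skew4 k e b d + skew4 k e a d * skew4 k e b c"
proof -
  assume e: "e * e = 1"
  have *: "e * (e * x) = x" for x using e by (simp flip: mult.assoc)
  consider "k = 1" | "k = 2" | "k \<noteq> 1" "k \<noteq> 2" by blast
  then show ?thesis
  proof cases
    case 1 then show ?thesis by (simp add: pfaffian4_def skew4_def det4_def minor4_def algebra_simps *)
  next
    case 2 then show ?thesis by (simp add: pfaffian4_def skew4_def det4_def minor4_def algebra_simps *)
  next
    case 3 then show ?thesis by (simp add: pfaffian4_def skew4_def det4_def minor4_def algebra_simps *)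
  qed
qed

lemma dot4_commute: "dot4 x y = dot4 y x"
  by (simp add: dot4_def mult.commute)

section \<open>Gram determinants against a frame\<close>

definition pairings :: "(nat \<Rightarrow> complex) \<Rightarrow> (nat \<Rightarrow> complex) \<Rightarrow> (nat \<Rightarrow> complex) \<Rightarrow> (nat \<Rightarrow> complex) \<Rightarrow> (nat \<Rightarrow> complex) \<Rightarrow> nat \<Rightarrow> complex" where
  "pairings a b c d x i = dot4 x (if i = 0 then a else if i = 1 then b else if i = 2 then c else d)"

lemma pairings_simps [simp]: "pairings a b c d x 0 = dot4 x a" "pairings a b c d x 1 = dot4 x b" "pairings a b c d x (Suc 0) = dot4 x b"
   "pairings a b c d x 2 = dot4 x c" "pairings a b c d x 3 = dot4 x d"
  by (simp_all add: pairings_def)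

lemma det4_pairings:
  "det4 x y z w * det4 a b c d = det4 (pairings a b c d x) (pairings a b c d y) (pairings a b c d z) (pairings a b c d w)"
  using det4_mult[of x "\<lambda>i. if i = 0 then a else if i = 1 then b else if i = 2 then c else d" y z w]
  by (simp add: pairings_def[abs_def])

lemma det4_nonsing:
  assumes "det4 a b c d \<noteq> 0" "dot4 x a = 0" "dot4 x b = 0" "dot4 x c = 0" "dot4 x d = 0"
  shows "x 0 = 0" "x 1 = 0" "x 2 = 0" "x 3 = 0"
proof -
  define e where "e = (\<lambda>a i. if i = (a::nat) then 1 else 0 :: complex)"
  have "det4 x y z w * det4 a b c d = 0" for y z w
    unfolding det4_pairings using assms by (simp add: det4_def minor4_def)
  then have "det4 x y z w = 0" for y z w using assms by simp
  \<comment> \<open>Unit vectors in the other three slots isolate one coordinate of x each.\<close>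
  from this[of "e 1" "e 2" "e 3"] this[of "e 0" "e 2" "e 3"] this[of "e 0" "e 1" "e 3"] this[of "e 0" "e 1" "e 2"]
  show "x 0 = 0" "x 1 = 0" "x 2 = 0" "x 3 = 0"
    by (simp_all add: det4_def minor4_def e_def)
qed

text \<open>In the application \<open>K\<close>, \<open>K1\<close>, \<open>K2\<close> are the Kummer coordinates at \<open>u\<close> and their two derivatives, \<open>L\<close> those at
  \<open>2u\<close>, \<open>K0\<close>, \<open>c11\<close>, \<open>c12\<close>, \<open>c22\<close> the value and the second derivatives at \<open>0\<close>, and \<open>(x1, x2)\<close>, \<open>h11\<close>, \<open>h12\<close>, \<open>h22\<close>
  the gradient and the Hessian of \<open>\<theta>\<close> at \<open>u\<close>; \<open>X\<close> is \<open>\<theta>\<^sub>j(2u)\<close>, \<open>(g1, g2)\<close> the gradient of \<open>\<theta>\<^sub>j\<close> at \<open>0\<close>, and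
  \<open>t = \<theta>(3u)\<close>.\<close>

lemma theta_divisor_algebra:
  fixes K0 c11 c12 c22 K K1 K2 L :: "nat \<Rightarrow> complex"
    and x1 x2 h11 h12 h22 t :: complex and X g1 g2 :: "nat \<Rightarrow> complex \<Rightarrow> complex"
  defines "d \<equiv> det4 K0 c11 c12 c22"
  defines "\<eta> \<equiv> h11 * x2\<^sup>2 - 2 * h12 * x1 * x2 + h22 * x1\<^sup>2"
  assumes K: "dot4 K K0 = 0" "dot4 K c11 = - 2 * x1 * x1" "dot4 K c12 = - 2 * x1 * x2" "dot4 K c22 = - 2 * x2 * x2"
    and K1: "dot4 K1 K0 = 0" "dot4 K1 c11 = - 2 * x1 * h11" "dot4 K1 c12 = - 2 * h11 * x2"
      "dot4 K1 c22 = 2 * x1 * h22 - 4 * h12 * x2"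
    and K2: "dot4 K2 K0 = 0" "dot4 K2 c11 = 2 * x2 * h11 - 4 * h12 * x1" "dot4 K2 c12 = - 2 * x1 * h22"
      "dot4 K2 c22 = - 2 * x2 * h22"
    and L: "dot4 K L = 0" "dot4 K1 L = - t * x1" "dot4 K2 L = - t * x2"
    and skew4: "\<And>k e. e * e = 1 \<Longrightarrow> skew4 k e K K1 = - X k e * g1 k e"
      "\<And>k e. e * e = 1 \<Longrightarrow> skew4 k e K K2 = - X k e * g2 k e"
      "\<And>k e. e * e = 1 \<Longrightarrow> skew4 k e L K0 = X k e * X k e"
      "\<And>k e. e * e = 1 \<Longrightarrow> skew4 k e c11 K0 = 2 * g1 k e * g1 k e"
      "\<And>k e. e * e = 1 \<Longrightarrow> skew4 k e c12 K0 = 2 * g1 k e * g2 k e"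
      "\<And>k e. e * e = 1 \<Longrightarrow> skew4 k e c22 K0 = 2 * g2 k e * g2 k e"
    and nz: "\<exists>i\<in>{0, 1, 2, 3}. K i \<noteq> 0" "a \<in> {0, 1, 2, 3}" "K0 a \<noteq> 0"
  shows "d\<^sup>2 * t = - 64 * \<eta> ^ 3"
proof -
  \<comment> \<open>A unit vector at a nonzero coordinate of \<open>K0\<close>, used as a filler row
    whose pairing with \<open>K0\<close> is known to be nonzero.\<close>
  define Ea where "Ea = (\<lambda>i. if i = a then 1 else 0 :: complex)"
  have Ea: "dot4 Ea K0 = K0 a"
    using nz(2) by (auto simp: dot4_def Ea_def)
  \<comment> \<open>K, K1 and K2 are orthogonal to \<open>K0\<close>, so the Gram determinant is, up
    to sign, the pairing of Z with \<open>K0\<close> times a 3 by 3 determinant in gradient and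
    Hessian.\<close>
  have E1: "det4 K K1 K2 Z * d = 8 * \<eta>\<^sup>2 * dot4 Z K0" for Z
    unfolding d_def det4_pairings \<eta>_def by (simp add: det4_def minor4_def K K1 K2) algebra
  consider "d = 0" | "d \<noteq> 0" "\<eta> = 0" | "d \<noteq> 0" "\<eta> \<noteq> 0" by blast
  then show ?thesis
  proof cases
    case 1
    then have "\<eta> = 0" using E1[of Ea] Ea nz(3) by simp
    with 1 show ?thesis by simp
  next
    case 2
    have x: "x1 \<noteq> 0 \<or> x2 \<noteq> 0"
    proof (rule ccontr)
      assume "\<not> ?thesis"
      then have "K 0 = 0" "K 1 = 0" "K 2 = 0" "K 3 = 0"
        using det4_nonsing[of K0 c11 c12 c22 K] 2 K unfolding d_def by auto
      then show False using nz(1) by auto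
    qed
    have zero: "x 0 = 0" "x 1 = 0" "x 2 = 0" "x 3 = 0"
      if "dot4 x K0 = 0" "dot4 x c11 = 0" "dot4 x c12 = 0" "dot4 x c22 = 0" for x
      using det4_nonsing[of K0 c11 c12 c22 x] 2 that unfolding d_def by auto
    have lin: "dot4 (\<lambda>i. u * y i - v * z i) w = u * dot4 y w - v * dot4 z w" for u v y z w
      by (simp add: dot4_def algebra_simps)
    have kill: "dot4 x y = 0" if "dot4 x K0 = 0" "dot4 x c11 = 0" "dot4 x c12 = 0" "dot4 x c22 = 0" for x y
      unfolding dot4_def zero[OF that] by simp
    \<comment> \<open>This combination is orthogonal to \<open>K0\<close>, \<open>c11\<close>,
      \<open>c12\<close> identically and pairs with \<open>c22\<close> to 2 \<open>\<eta>\<close> =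
      0. As d is nonzero it is the zero vector, while its pairing with L is -t times the square of
      x1.\<close>
    have "dot4 (\<lambda>i. x1 * K1 i - h11 * K i) L = 0"
    proof -
      have "x1 * (2 * x1 * h22 - 4 * h12 * x2) - h11 * (- 2 * x2 * x2) = 2 * \<eta>"
        unfolding \<eta>_def by algebra
      then have "dot4 (\<lambda>i. x1 * K1 i - h11 * K i) c22 = 0"
        unfolding lin K K1 using 2 by simp
      then show ?thesis
        by (rule kill[rotated 3]) (simp_all add: lin K K1)
    qed
    then have t1: "x1 * (t * x1) = 0" unfolding lin L by simp
    have "dot4 (\<lambda>i. x2 * K2 i - h22 * K i) L = 0"
    proof -
      have "x2 * (2 * x2 * h11 - 4 * h12 * x1) - h22 * (- 2 * x1 * x1) = 2 * \<eta>"
        unfolding \<eta>_def by algebra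
      then have "dot4 (\<lambda>i. x2 * K2 i - h22 * K i) c11 = 0"
        unfolding lin K K2 using 2 by simp
      then show ?thesis
        by (rule kill[rotated 1]) (simp_all add: lin K K2)
    qed
    then have t2: "x2 * (t * x2) = 0" unfolding lin L by simp
    have "t = 0" using x t1 t2 by auto
    with 2 show ?thesis by simp
  next
    case 3
    \<comment> \<open>The derivative of K along the tangent (x2, -x1) of the theta divisor; h is the
      derivative of the odd theta function at 0 in the same direction.\<close>
    define K' where "K' = (\<lambda>i. x2 * K1 i - x1 * K2 i)"
    define h where "h = (\<lambda>k e. g1 k e * x2 - g2 k e * x1)"
    have K': "dot4 K' y = x2 * dot4 K1 y - x1 * dot4 K2 y" for y
      by (simp add: dot4_def K'_def algebra_simps)
    have omK': "skew4 k e K K' = - X k e * h k e" if "e * e = 1" for k e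
    proof -
      have "skew4 k e K K' = x2 * skew4 k e K K1 - x1 * skew4 k e K K2"
        by (simp add: skew4_def minor4_def K'_def algebra_simps)
      then show ?thesis using skew4[OF that] by (simp add: h_def algebra_simps)
    qed
    \<comment> \<open>If every h vanished, all six forms and hence all minors of (K, K') would
      vanish. Then (x1, x2) times the nonzero determinant of K, K1, K2, Ea would be 0, which
      contradicts \<open>\<eta>\<close> being nonzero.\<close>
    have "\<exists>k e. e * e = 1 \<and> h k e \<noteq> 0"
    proof (rule ccontr)
      assume "\<not> ?thesis"
      then have z: "skew4 k e K K' = 0" if "e * e = 1" for k e
        using omK'[OF that] that by auto
      have "minor4 K K' 0 1 = 0" "minor4 K K' 0 2 = 0" "minor4 K K' 0 3 = 0" "minor4 K K' 1 2 = 0" "minor4 K K' 1 3 = 0" "minor4 K K' 2 3 = 0"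
        using z[of 1 1] z[of "-1" 1] z[of 1 2] z[of "-1" 2] z[of 1 3] z[of "-1" 3] by (simp_all add: skew4_def)
      then have D: "det4 K K' y z = 0" for y z by (simp add: det4_def)
      have "det4 K K' K2 Ea = x2 * det4 K K1 K2 Ea"
        by (simp add: det4_def minor4_def K'_def) algebra
      moreover have "det4 K K' K1 Ea = x1 * det4 K K1 K2 Ea"
        by (simp add: det4_def minor4_def K'_def) algebra
      moreover have "det4 K K1 K2 Ea \<noteq> 0"
        using E1[of Ea] 3 nz(3) by (auto simp: Ea)
      ultimately have "x1 = 0" "x2 = 0" using D by auto
      then show False using 3 by (simp add: \<eta>_def)
    qed
    then obtain k e where e: "e * e = 1" and h: "h k e \<noteq> 0" by blast
    define P where "P = pfaffian4 k e"
    have P: "P * P = 1" using e by (simp add: P_def pfaffian4_def)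
    have skew: "skew4 k e x x = 0" for x using skew4_skew[of k e x x] by simp
    \<comment> \<open>The dual of L: \<open>skew4 k e x Z\<close> is minus the pairing of x with L.
      Since K is orthogonal to L, only terms containing t survive in the Pfaffian expansion.\<close>
    define Z where "Z = skew4_vec k e L"
    have Z: "skew4 k e x Z = - dot4 x L" for x
      unfolding skew4_dot Z_def by (rule skew4_vec_twice[OF e])
    have Z0: "dot4 Z K0 = - (X k e * X k e)"
      using skew4_dot[of k e K0 L] skew4_skew[of k e K0 L] skew4(3)[OF e, of k] by (simp add: Z_def dot4_commute)
    have 1: "P * det4 K K1 K2 Z = - X k e * t * h k e"
      unfolding P_def skew4_det4[OF e] Z skew4[OF e] L h_def by algebra
    have A1: "- X k e * t * h k e * d = P * (- 8 * \<eta>\<^sup>2 * (X k e * X k e))"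
      using E1[of Z] unfolding Z0 1[symmetric] by (simp add: mult.assoc)
    \<comment> \<open>The dual of \<open>K0\<close>: its pairings with \<open>c11\<close>,
      \<open>c12\<close>, \<open>c22\<close> are twice the products of g1 and g2, so that the Gram
      determinant below contains the square of h.\<close>
    define W where "W = skew4_vec k e K0"
    have W: "skew4 k e x W = - dot4 x K0" for x
      unfolding skew4_dot W_def by (rule skew4_vec_twice[OF e])
    have W': "dot4 W x = skew4 k e x K0" for x
      by (simp add: skew4_dot W_def dot4_commute)
    have WE: "skew4 k e W Ea = K0 a"
      using skew4_skew[of k e W Ea] W[of Ea] Ea by simp
    have 2: "P * det4 K K' W Ea = - X k e * h k e * K0 a"
      unfolding P_def skew4_det4[OF e] W omK'[OF e] WE K' K K1 K2 by simp
    have "det4 K K' W Ea * d = 8 * (h k e)\<^sup>2 * \<eta> * K0 a"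
      unfolding d_def det4_pairings \<eta>_def h_def
      by (simp add: det4_def minor4_def K K' K1 K2 W' skew4[OF e] skew Ea) algebra
    then have "- X k e * h k e * K0 a * d = P * (8 * (h k e)\<^sup>2 * \<eta> * K0 a)"
      unfolding 2[symmetric] by (simp add: mult.assoc)
    then have A2: "X k e * d = - 8 * P * h k e * \<eta>"
      using h nz(3) by (simp add: power2_eq_square) algebra
    have Pnz: "P \<noteq> 0" using P by auto
    have X: "X k e \<noteq> 0"
      using A2 h 3 Pnz by auto
    have A3: "t * h k e * d = 8 * P * \<eta>\<^sup>2 * X k e"
      using A1 X by (simp add: power2_eq_square) algebra
    have "h k e * (d\<^sup>2 * t) = (t * h k e * d) * d" by algebra
    also have "\<dots> = 8 * P * \<eta>\<^sup>2 * (X k e * d)" unfolding A3 by simp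
    also have "\<dots> = h k e * (- 64 * \<eta> ^ 3) * (P * P)" unfolding A2 by algebra
    finally have "h k e * (d\<^sup>2 * t) = h k e * (- 64 * \<eta> ^ 3)" using P by simp
    then show ?thesis using mult_left_cancel[OF h] by blast
  qed
qed

section \<open>Consequences of an addition formula\<close>

text \<open>A template for all theta functions with an addition theorem: indices count derivatives,
  and B stands for a bilinear pairing of derivatives of K at (x1, x2) and (y1, y2). The Taylor
  coefficients are thus computed once.\<close>

locale addition_formula =
  fixes f :: "nat \<Rightarrow> nat \<Rightarrow> complex \<Rightarrow> complex \<Rightarrow> complex"
    and B :: "nat \<Rightarrow> nat \<Rightarrow> nat \<Rightarrow> nat \<Rightarrow> complex \<Rightarrow> complex \<Rightarrow> complex \<Rightarrow> complex \<Rightarrow> complex"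
  assumes f1: "\<And>j k z w. ((\<lambda>z. f j k z w) has_field_derivative f (Suc j) k z w) (at z)"
    and f2: "\<And>j k z w. ((\<lambda>w. f j k z w) has_field_derivative f j (Suc k) z w) (at w)"
    and B1: "\<And>i j k l x1 x2 y1 y2. ((\<lambda>x1. B i j k l x1 x2 y1 y2) has_field_derivative B (Suc i) j k l x1 x2 y1 y2) (at x1)"
    and B2: "\<And>i j k l x1 x2 y1 y2. ((\<lambda>x2. B i j k l x1 x2 y1 y2) has_field_derivative B i (Suc j) k l x1 x2 y1 y2) (at x2)"
    and B3: "\<And>i j k l x1 x2 y1 y2. ((\<lambda>y1. B i j k l x1 x2 y1 y2) has_field_derivative B i j (Suc k) l x1 x2 y1 y2) (at y1)"
    and B4: "\<And>i j k l x1 x2 y1 y2. ((\<lambda>y2. B i j k l x1 x2 y1 y2) has_field_derivative B i j k (Suc l) x1 x2 y1 y2) (at y2)"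
    and product: "\<And>x1 x2 y1 y2. f 0 0 (x1 + y1) (x2 + y2) * f 0 0 (x1 - y1) (x2 - y2) = B 0 0 0 0 x1 x2 y1 y2"
begin

lemmas fchain = DERIV_chain2[OF f1, THEN DERIV_cong] DERIV_chain2[OF f2, THEN DERIV_cong]

lemma D_y1: "B 0 0 1 0 x1 x2 y1 y2 = f 1 0 (x1 + y1) (x2 + y2) * f 0 0 (x1 - y1) (x2 - y2) - f 0 0 (x1 + y1) (x2 + y2) * f 1 0 (x1 - y1) (x2 - y2)"
  by (rule DERIV_unique[OF B3[of 0 0 0 0, folded product One_nat_def]]) (auto intro!: derivative_eq_intros fchain)

lemma D_y2: "B 0 0 0 1 x1 x2 y1 y2 = f 0 1 (x1 + y1) (x2 + y2) * f 0 0 (x1 - y1) (x2 - y2) - f 0 0 (x1 + y1) (x2 + y2) * f 0 1 (x1 - y1) (x2 - y2)"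
  by (rule DERIV_unique[OF B4[of 0 0 0 0, folded product One_nat_def]]) (auto intro!: derivative_eq_intros fchain)

lemma D_y11: "B 0 0 2 0 x1 x2 0 0 = 2 * f 2 0 x1 x2 * f 0 0 x1 x2 - 2 * (f 1 0 x1 x2)\<^sup>2"
proof -
  have "((\<lambda>y1. B 0 0 1 0 x1 x2 y1 0) has_field_derivative 2 * f 2 0 x1 x2 * f 0 0 x1 x2 - 2 * (f 1 0 x1 x2)\<^sup>2) (at 0)"
    unfolding D_y1 by (auto intro!: derivative_eq_intros fchain simp: power2_eq_square numeral_2_eq_2)
  from DERIV_unique[OF B3[of 0 0 1 0] this] show ?thesis by (simp add: numeral_2_eq_2)
qed

lemma D_y12: "B 0 0 1 1 x1 x2 0 0 = 2 * f 1 1 x1 x2 * f 0 0 x1 x2 - 2 * f 1 0 x1 x2 * f 0 1 x1 x2"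
proof -
  have "((\<lambda>y2. B 0 0 1 0 x1 x2 0 y2) has_field_derivative 2 * f 1 1 x1 x2 * f 0 0 x1 x2 - 2 * f 1 0 x1 x2 * f 0 1 x1 x2) (at 0)"
    unfolding D_y1 by (auto intro!: derivative_eq_intros fchain simp: power2_eq_square)
  from DERIV_unique[OF B4[of 0 0 1 0] this] show ?thesis by simp
qed

lemma D_y22: "B 0 0 0 2 x1 x2 0 0 = 2 * f 0 2 x1 x2 * f 0 0 x1 x2 - 2 * (f 0 1 x1 x2)\<^sup>2"
proof -
  have "((\<lambda>y2. B 0 0 0 1 x1 x2 0 y2) has_field_derivative 2 * f 0 2 x1 x2 * f 0 0 x1 x2 - 2 * (f 0 1 x1 x2)\<^sup>2) (at 0)"
    unfolding D_y2 by (auto intro!: derivative_eq_intros fchain simp: power2_eq_square numeral_2_eq_2)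
  from DERIV_unique[OF B4[of 0 0 0 1] this] show ?thesis by (simp add: numeral_2_eq_2)
qed

text \<open>The third derivative is multiplied by \<open>f 0 0\<close>, so at a zero of f only
  gradient and Hessian remain; the same holds for the next five coefficients.\<close>

lemma D_x1y11: "B 1 0 2 0 x1 x2 0 0 = 2 * f 3 0 x1 x2 * f 0 0 x1 x2 - 2 * f 2 0 x1 x2 * f 1 0 x1 x2"
  by (rule DERIV_unique[OF B1[of 0 0 2 0 x2 0 0, unfolded D_y11, folded One_nat_def]])
     (auto intro!: derivative_eq_intros fchain simp: numeral_eq_Suc)

lemma D_x2y11: "B 0 1 2 0 x1 x2 0 0 = 2 * f 2 1 x1 x2 * f 0 0 x1 x2 + 2 * f 2 0 x1 x2 * f 0 1 x1 x2 - 4 * f 1 0 x1 x2 * f 1 1 x1 x2"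
  by (rule DERIV_unique[OF B2[of 0 0 2 0 x1 0 0, unfolded D_y11, folded One_nat_def]])
     (auto intro!: derivative_eq_intros fchain simp: numeral_eq_Suc)

lemma D_x1y12: "B 1 0 1 1 x1 x2 0 0 = 2 * f 2 1 x1 x2 * f 0 0 x1 x2 - 2 * f 2 0 x1 x2 * f 0 1 x1 x2"
  by (rule DERIV_unique[OF B1[of 0 0 1 1 x2 0 0, unfolded D_y12, folded One_nat_def]])
     (auto intro!: derivative_eq_intros fchain simp: numeral_eq_Suc)

lemma D_x2y12: "B 0 1 1 1 x1 x2 0 0 = 2 * f 1 2 x1 x2 * f 0 0 x1 x2 - 2 * f 1 0 x1 x2 * f 0 2 x1 x2"
  by (rule DERIV_unique[OF B2[of 0 0 1 1 x1 0 0, unfolded D_y12, folded One_nat_def]])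
     (auto intro!: derivative_eq_intros fchain simp: numeral_eq_Suc)

lemma D_x1y22: "B 1 0 0 2 x1 x2 0 0 = 2 * f 1 2 x1 x2 * f 0 0 x1 x2 + 2 * f 0 2 x1 x2 * f 1 0 x1 x2 - 4 * f 0 1 x1 x2 * f 1 1 x1 x2"
  by (rule DERIV_unique[OF B1[of 0 0 0 2 x2 0 0, unfolded D_y22, folded One_nat_def]])
     (auto intro!: derivative_eq_intros fchain simp: numeral_eq_Suc)

lemma D_x2y22: "B 0 1 0 2 x1 x2 0 0 = 2 * f 0 3 x1 x2 * f 0 0 x1 x2 - 2 * f 0 2 x1 x2 * f 0 1 x1 x2"
  by (rule DERIV_unique[OF B2[of 0 0 0 2 x1 0 0, unfolded D_y22, folded One_nat_def]])
     (auto intro!: derivative_eq_intros fchain simp: numeral_eq_Suc)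

lemma D_y0: "B 0 0 0 0 x1 x2 0 0 = f 0 0 x1 x2 * f 0 0 x1 x2"
  using product[of x1 0 x2 0] by simp

lemma D_x1: "B 1 0 0 0 x1 x2 0 0 = 2 * f 0 0 x1 x2 * f 1 0 x1 x2"
  by (rule DERIV_unique[OF B1[of 0 0 0 0 x2 0 0, unfolded D_y0, folded One_nat_def]])
     (auto intro!: derivative_eq_intros fchain simp: numeral_eq_Suc)

lemma D_x2: "B 0 1 0 0 x1 x2 0 0 = 2 * f 0 0 x1 x2 * f 0 1 x1 x2"
  by (rule DERIV_unique[OF B2[of 0 0 0 0 x1 0 0, unfolded D_y0, folded One_nat_def]])
     (auto intro!: derivative_eq_intros fchain simp: numeral_eq_Suc)

lemma D_x11: "B 2 0 0 0 x1 x2 0 0 = 2 * (f 1 0 x1 x2)\<^sup>2 + 2 * f 0 0 x1 x2 * f 2 0 x1 x2"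
proof -
  have "((\<lambda>x1. B 1 0 0 0 x1 x2 0 0) has_field_derivative 2 * (f 1 0 x1 x2)\<^sup>2 + 2 * f 0 0 x1 x2 * f 2 0 x1 x2) (at x1)"
    unfolding D_x1 by (auto intro!: derivative_eq_intros fchain simp: numeral_eq_Suc)
  from DERIV_unique[OF B1[of 1 0 0 0] this] show ?thesis by (simp add: numeral_2_eq_2)
qed

lemma D_x12: "B 1 1 0 0 x1 x2 0 0 = 2 * f 1 0 x1 x2 * f 0 1 x1 x2 + 2 * f 0 0 x1 x2 * f 1 1 x1 x2"
proof -
  have "((\<lambda>x2. B 1 0 0 0 x1 x2 0 0) has_field_derivative 2 * f 1 0 x1 x2 * f 0 1 x1 x2 + 2 * f 0 0 x1 x2 * f 1 1 x1 x2) (at x2)"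
    unfolding D_x1 by (auto intro!: derivative_eq_intros fchain simp: numeral_eq_Suc)
  from DERIV_unique[OF B2[of 1 0 0 0] this] show ?thesis by (simp add: numeral_2_eq_2)
qed

lemma D_x22: "B 0 2 0 0 x1 x2 0 0 = 2 * (f 0 1 x1 x2)\<^sup>2 + 2 * f 0 0 x1 x2 * f 0 2 x1 x2"
proof -
  have "((\<lambda>x2. B 0 1 0 0 x1 x2 0 0) has_field_derivative 2 * (f 0 1 x1 x2)\<^sup>2 + 2 * f 0 0 x1 x2 * f 0 2 x1 x2) (at x2)"
    unfolding D_x2 by (auto intro!: derivative_eq_intros fchain simp: numeral_eq_Suc)
  from DERIV_unique[OF B2[of 0 1 0 0] this] show ?thesis by (simp add: numeral_2_eq_2)
qed

end

section \<open>The theta divisor\<close>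

lemma im_ge_scale:
  assumes "im_ge c p q r" "t \<ge> 0"
  shows "im_ge (t * c) (of_real t * p) (of_real t * q) (of_real t * r)"
  unfolding im_ge_def
proof (intro allI)
  fix u v
  have "c * (u\<^sup>2 + v\<^sup>2) \<le> qform (Im p) (Im q) (Im r) u v"
    using assms by (simp add: im_ge_def)
  from mult_left_mono[OF this assms(2)]
  show "t * c * (u\<^sup>2 + v\<^sup>2) \<le> qform (Im (of_real t * p)) (Im (of_real t * q)) (Im (of_real t * r)) u v"
    by (simp add: qform_def algebra_simps)
qed

lemma im_ge_double: "im_ge c p q r \<Longrightarrow> im_ge (2 * c) (2 * p) (2 * q) (2 * r)"
  using im_ge_scale[of c p q r 2] by simp

text \<open>The indices \<open>0\<close>, \<open>1\<close>, \<open>2\<close>, \<open>3\<close> stand for the half-integral vectors \<open>(0, 0)\<close>, \<open>(1/2, 0)\<close>, \<open>(0, 1/2)\<close>, \<open>(1/2, 1/2)\<close>.\<close>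

definition half1 :: "nat \<Rightarrow> real" where "half1 i = (if i = 1 \<or> i = 3 then 1/2 else 0)"
definition half2 :: "nat \<Rightarrow> real" where "half2 i = (if i = 2 \<or> i = 3 then 1/2 else 0)"

lemma half12 [simp]: "half1 0 = 0" "half1 1 = 1/2" "half1 (Suc 0) = 1/2" "half1 2 = 0" "half1 3 = 1/2"
  "half2 0 = 0" "half2 1 = 0" "half2 (Suc 0) = 0" "half2 2 = 1/2" "half2 3 = 1/2"
  by (simp_all add: half1_def half2_def)

text \<open>The odd characteristic whose addition formula is governed by \<open>skew4 n e\<close>.\<close>

definition odd_a1 :: "nat \<Rightarrow> real" where "odd_a1 k = (if k = 2 then 0 else 1/2)"
definition odd_a2 :: "nat \<Rightarrow> real" where "odd_a2 k = (if k = 1 then 0 else 1/2)"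
definition odd_b1 :: "nat \<Rightarrow> complex \<Rightarrow> complex" where "odd_b1 k e = (if k = 1 \<or> e \<noteq> 1 then 1/2 else 0)"
definition odd_b2 :: "nat \<Rightarrow> complex \<Rightarrow> complex" where "odd_b2 k e = (if k = 2 then 1/2 else if k = 1 \<longleftrightarrow> e = 1 then 0 else 1/2)"

lemma sum_bits: "(\<Sum>(s, t)\<in>{0, 1::int} \<times> {0, 1::int}. g s t) = g 0 0 + g 1 0 + (g 0 1 + g 1 1 :: complex)"
  unfolding sum.cartesian_product[symmetric] by simp

lemma exp_2pi_half [simp]: "exp (2 * of_real pi * \<i> * of_real (1/2)) = (-1 :: complex)" "exp (2 * of_real pi * \<i> * of_real 0) = (1 :: complex)"
  by (simp_all add: mult.assoc exp_pi_i)

locale siegel_point =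
  fixes p q r :: complex and c :: real
  assumes pd: "im_ge c p q r" and cpos: "c > 0"
begin

definition rtheta where "rtheta j k z w = theta2 0 0 j k p q r z w"
text \<open>The power of 2 is the chain-rule factor of the argument 2z, so that j and k count
  derivatives in z and w themselves.\<close>

definition kummer where "kummer j k z w i = 2 ^ (j + k) * theta2 (half1 i) (half2 i) j k (2 * p) (2 * q) (2 * r) (2 * z) (2 * w)"
definition otheta where "otheta n e j k z w = theta2 (odd_a1 n) (odd_a2 n) j k p q r (z + odd_b1 n e) (w + odd_b2 n e)"

lemma im_ge2: "im_ge (2 * c) (2 * p) (2 * q) (2 * r)" "2 * c > 0"
  using im_ge_double[OF pd] cpos by simp_all

lemma kummer_deriv1: "((\<lambda>z. kummer j k z w i) has_field_derivative kummer (Suc j) k z w i) (at z)"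
  unfolding kummer_def by (rule DERIV_cong, (rule derivative_intros DERIV_chain2[OF theta2_deriv1[OF im_ge2]])+) simp

lemma kummer_deriv2: "((\<lambda>w. kummer j k z w i) has_field_derivative kummer j (Suc k) z w i) (at w)"
  unfolding kummer_def by (rule DERIV_cong, (rule derivative_intros DERIV_chain2[OF theta2_deriv2[OF im_ge2]])+) simp

lemma theta_add: "rtheta 0 0 (x1 + y1) (x2 + y2) * rtheta 0 0 (x1 - y1) (x2 - y2) = dot4 (kummer 0 0 x1 x2) (kummer 0 0 y1 y2)"
  unfolding rtheta_def theta2_add[OF pd cpos] sum_bits by (simp add: dot4_def kummer_def)

text \<open>The half-period b is moved into x. Doubled, it is an integral period and contributes
  only signs, which arrange the four products into two complementary minors.\<close>

lemma odd_add:
  assumes "e * e = 1"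
  shows "otheta n e 0 0 (x1 + y1) (x2 + y2) * otheta n e 0 0 (x1 - y1) (x2 - y2) = skew4 n e (kummer 0 0 x1 x2) (kummer 0 0 y1 y2)"
proof -
  have e: "e = 1 \<or> e = -1" using assms by (simp add: square_eq_1_iff)
  have sh: "otheta n e 0 0 (x1 + y1) (x2 + y2) * otheta n e 0 0 (x1 - y1) (x2 - y2) =
    theta2 (odd_a1 n) (odd_a2 n) 0 0 p q r ((x1 + odd_b1 n e) + y1) ((x2 + odd_b2 n e) + y2) *
    theta2 (odd_a1 n) (odd_a2 n) 0 0 p q r ((x1 + odd_b1 n e) - y1) ((x2 + odd_b2 n e) - y2)"
    by (simp add: otheta_def add_ac diff_add_eq)
  have sh2: "2 * (x + 1/2) = 2 * x + 1" for x :: complex by simp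
  consider "n = 1" | "n = 2" | "n \<noteq> 1" "n \<noteq> 2" by blast
  then show ?thesis
  proof cases
    case 1
    with e show ?thesis
      unfolding sh theta2_add[OF pd cpos] sum_bits
      by (auto simp: skew4_def minor4_def kummer_def odd_a1_def odd_a2_def odd_b1_def odd_b2_def theta2_period1 theta2_period2 sh2 simp del: distrib_left_numeral)
  next
    case 2
    with e show ?thesis
      unfolding sh theta2_add[OF pd cpos] sum_bits
      by (auto simp: skew4_def minor4_def kummer_def odd_a1_def odd_a2_def odd_b1_def odd_b2_def theta2_period1 theta2_period2 sh2 simp del: distrib_left_numeral)
  next
    case 3
    with e show ?thesis
      unfolding sh theta2_add[OF pd cpos] sum_bits
      by (auto simp: skew4_def minor4_def kummer_def odd_a1_def odd_a2_def odd_b1_def odd_b2_def theta2_period1 theta2_period2 sh2 simp del: distrib_left_numeral)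
  qed
qed

lemma theta_addition_formula: "addition_formula rtheta (\<lambda>i j k l x1 x2 y1 y2. dot4 (kummer i j x1 x2) (kummer k l y1 y2))"
proof
  show "((\<lambda>z. rtheta j k z w) has_field_derivative rtheta (Suc j) k z w) (at z)" for j k z w
    unfolding rtheta_def by (rule theta2_deriv1[OF pd cpos])
  show "((\<lambda>w. rtheta j k z w) has_field_derivative rtheta j (Suc k) z w) (at w)" for j k z w
    unfolding rtheta_def by (rule theta2_deriv2[OF pd cpos])
qed (auto simp: dot4_def theta_add intro!: derivative_eq_intros kummer_deriv1 kummer_deriv2)

lemma odd_addition_formula:
  assumes e: "e * e = 1"
  shows "addition_formula (otheta n e) (\<lambda>i j k l x1 x2 y1 y2. skew4 n e (kummer i j x1 x2) (kummer k l y1 y2))"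
proof
  show "((\<lambda>z. otheta n e j k z w) has_field_derivative otheta n e (Suc j) k z w) (at z)" for j k z w
    unfolding otheta_def by (auto intro!: derivative_eq_intros DERIV_chain2[OF theta2_deriv1[OF pd cpos], THEN DERIV_cong])
  show "((\<lambda>w. otheta n e j k z w) has_field_derivative otheta n e j (Suc k) z w) (at w)" for j k z w
    unfolding otheta_def by (auto intro!: derivative_eq_intros DERIV_chain2[OF theta2_deriv2[OF pd cpos], THEN DERIV_cong])
qed (auto simp: skew4_dot dot4_def skew4_vec_def odd_add[OF e] intro!: derivative_eq_intros kummer_deriv1 kummer_deriv2)

text \<open>On the line, g(s) g(-s) = 0. If g(1) were nonzero, g would have no zeros near 1, hence
  vanish near -1 and then on the whole disc. This is what excludes K(u) = 0 unless
  \<open>\<theta>\<close> is identically zero.\<close>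

lemma theta_line_zero:
  assumes "\<And>s. rtheta 0 0 (u1 + s * d1) (u2 + s * d2) * rtheta 0 0 (u1 - s * d1) (u2 - s * d2) = 0"
  shows "rtheta 0 0 (u1 + d1) (u2 + d2) = 0"
proof (rule ccontr)
  define g where "g = (\<lambda>s. rtheta 0 0 (u1 + s * d1) (u2 + s * d2))"
  define S :: "complex set" where "S = ball 0 3"
  define R where "R = norm u1 + norm u2 + 3 * norm d1 + 3 * norm d2"
  assume "\<not> ?thesis"
  then have g1: "g 1 \<noteq> 0" by (simp add: g_def)
  have bd: "norm (u + s * d) \<le> norm u + 3 * norm d" if "s \<in> S" for u s d
    using norm_triangle_ineq[of u "s * d"] mult_right_mono[of "norm s" 3 "norm d"] that
    by (simp add: norm_mult S_def)
  have g: "g holomorphic_on S"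
    unfolding g_def rtheta_def
  proof (rule theta2_holomorphic[OF _ cpos _ _ _ _ _ pd, where R = R])
    show "norm (u1 + s * d1) \<le> R" "norm (u2 + s * d2) \<le> R" if "s \<in> S" for s
      using bd[OF that, of u1 d1] bd[OF that, of u2 d2] norm_ge_zero[of u1] norm_ge_zero[of u2] norm_ge_zero[of d1] norm_ge_zero[of d2]
      unfolding R_def by linarith+
  qed (auto simp: S_def intro!: holomorphic_intros)
  have "1 \<in> S" by (simp add: S_def)
  then obtain e where e: "e > 0" "\<And>s. s \<in> S \<Longrightarrow> dist s 1 < e \<Longrightarrow> dist (g s) (g 1) < norm (g 1)"
    using holomorphic_on_imp_continuous_on[OF g] g1 unfolding continuous_on_iff by (meson zero_less_norm_iff)
  define U :: "complex set" where "U = ball (-1) (min e 1)"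
  have US: "U \<subseteq> S"
  proof
    fix s assume "s \<in> U"
    then have "dist (-1) s < 1" by (simp add: U_def)
    then have "norm s < 3" using norm_triangle_ineq3[of "-1" s] by (simp add: dist_norm)
    then show "s \<in> S" by (simp add: S_def)
  qed
  have "g 1 = 0"
  proof (rule analytic_continuation[OF g, of U "-1"])
    show "- 1 islimpt U"
      by (intro interior_limit_point) (use e in \<open>auto simp: U_def interior_open\<close>)
    fix s assume s: "s \<in> U"
    then have s': "- s \<in> S" using US by (auto simp: S_def)
    have "dist (- s) 1 < e" using s by (simp add: U_def dist_norm norm_minus_commute add.commute) 
    then have "g (- s) \<noteq> 0" using e(2)[OF s'] by (auto simp: dist_norm)
    moreover have "g s * g (- s) = 0" using assms[of s] by (simp add: g_def)
    ultimately show "g s = 0" by simp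
  qed (use US in \<open>auto simp: S_def\<close>)
  with g1 show False by simp
qed

lemma theta_divisor_cube:
  assumes u: "rtheta 0 0 u1 u2 = 0"
  shows "(det4 (kummer 0 0 0 0) (kummer 2 0 0 0) (kummer 1 1 0 0) (kummer 0 2 0 0))\<^sup>2 * rtheta 0 0 (3 * u1) (3 * u2) =
    - 64 * (rtheta 2 0 u1 u2 * (rtheta 0 1 u1 u2)\<^sup>2 - 2 * rtheta 1 1 u1 u2 * rtheta 1 0 u1 u2 * rtheta 0 1 u1 u2 + rtheta 0 2 u1 u2 * (rtheta 1 0 u1 u2)\<^sup>2) ^ 3"
proof (cases "\<forall>z w. rtheta 0 0 z w = 0")
  \<comment> \<open>The gradient vanishes as well, so both sides are 0.\<close>
  case True
  interpret addition_formula rtheta "\<lambda>i j k l x1 x2 y1 y2. dot4 (kummer i j x1 x2) (kummer k l y1 y2)" by (rule theta_addition_formula)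
  have "rtheta 1 0 z w = 0" for z w
    using DERIV_unique[OF f1[of 0 0 w z]] True by (simp add: One_nat_def[symmetric] del: One_nat_def)
  moreover have "rtheta 0 1 z w = 0" for z w
    using DERIV_unique[OF f2[of 0 0 z w]] True by (simp add: One_nat_def[symmetric] del: One_nat_def)
  ultimately show ?thesis using True by simp
next
  case False
  interpret E: addition_formula rtheta "\<lambda>i j k l x1 x2 y1 y2. dot4 (kummer i j x1 x2) (kummer k l y1 y2)" by (rule theta_addition_formula)
  have K0: "\<exists>a\<in>{0, 1, 2, 3}. kummer 0 0 0 0 a \<noteq> 0"
  proof (rule ccontr)
    assume "\<not> ?thesis"
    then have "dot4 (kummer 0 0 z w) (kummer 0 0 0 0) = 0" for z w by (simp add: dot4_def)
    then have "rtheta 0 0 z w = 0" for z w using theta_add[of z 0 w 0] by simp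
    with False show False by simp
  qed
  then obtain a where a: "a \<in> {0, 1, 2, 3}" "kummer 0 0 0 0 a \<noteq> 0" by blast
  have Knz: "\<exists>i\<in>{0, 1, 2, 3}. kummer 0 0 u1 u2 i \<noteq> 0"
  proof (rule ccontr)
    assume "\<not> ?thesis"
    then have "dot4 (kummer 0 0 u1 u2) y = 0" for y by (simp add: dot4_def)
    then have "rtheta 0 0 (u1 + d1) (u2 + d2) = 0" for d1 d2
      by (intro theta_line_zero) (simp add: theta_add)
    from this[of "z - u1" "w - u2" for z w] have "rtheta 0 0 z w = 0" for z w by simp
    with False show False by simp
  qed
  note O = addition_formula.D_y1[OF odd_addition_formula] addition_formula.D_y2[OF odd_addition_formula] addition_formula.D_y0[OF odd_addition_formula]
    addition_formula.D_x11[OF odd_addition_formula] addition_formula.D_x12[OF odd_addition_formula] addition_formula.D_x22[OF odd_addition_formula]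
  have od0: "otheta k e 0 0 0 0 = 0" if "e * e = 1" for k e
    using odd_add[OF that, of k 0 0 0 0] skew4_skew[of k e "kummer 0 0 0 0" "kummer 0 0 0 0"] by simp
  show ?thesis
  proof (rule theta_divisor_algebra[where K = "kummer 0 0 u1 u2" and ?K1.0 = "kummer 1 0 u1 u2" and ?K2.0 = "kummer 0 1 u1 u2"
      and L = "kummer 0 0 (2 * u1) (2 * u2)" and X = "\<lambda>k e. otheta k e 0 0 (2 * u1) (2 * u2)"
      and ?g1.0 = "\<lambda>k e. otheta k e 1 0 0 0" and ?g2.0 = "\<lambda>k e. otheta k e 0 1 0 0"])
    have "dot4 (kummer 0 0 (2 * u1) (2 * u2)) (kummer 0 0 u1 u2) = 0"
      using E.product[of "2 * u1" u1 "2 * u2" u2] u by simp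
    then show "dot4 (kummer 0 0 u1 u2) (kummer 0 0 (2 * u1) (2 * u2)) = 0" by (simp add: dot4_commute)
    show "dot4 (kummer 1 0 u1 u2) (kummer 0 0 (2 * u1) (2 * u2)) = - rtheta 0 0 (3 * u1) (3 * u2) * rtheta 1 0 u1 u2"
      using E.D_y1[of "2 * u1" "2 * u2" u1 u2] u by (simp add: dot4_commute)
    show "dot4 (kummer 0 1 u1 u2) (kummer 0 0 (2 * u1) (2 * u2)) = - rtheta 0 0 (3 * u1) (3 * u2) * rtheta 0 1 u1 u2"
      using E.D_y2[of "2 * u1" "2 * u2" u1 u2] u by (simp add: dot4_commute)
  next
    fix k e assume e: "e * e = (1::complex)"
    \<comment> \<open>Taken at x = y = u, where the factor at x - y = 0 vanishes and x + y =
      2u.\<close>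
    show "skew4 k e (kummer 0 0 u1 u2) (kummer 1 0 u1 u2) = - otheta k e 0 0 (2 * u1) (2 * u2) * otheta k e 1 0 0 0"
      "skew4 k e (kummer 0 0 u1 u2) (kummer 0 1 u1 u2) = - otheta k e 0 0 (2 * u1) (2 * u2) * otheta k e 0 1 0 0"
      unfolding O[OF e] by (simp_all add: od0[OF e])
    show "skew4 k e (kummer 0 0 (2 * u1) (2 * u2)) (kummer 0 0 0 0) = otheta k e 0 0 (2 * u1) (2 * u2) * otheta k e 0 0 (2 * u1) (2 * u2)"
      by (rule O(3)[OF e])
    show "skew4 k e (kummer 2 0 0 0) (kummer 0 0 0 0) = 2 * otheta k e 1 0 0 0 * otheta k e 1 0 0 0"
      "skew4 k e (kummer 1 1 0 0) (kummer 0 0 0 0) = 2 * otheta k e 1 0 0 0 * otheta k e 0 1 0 0"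
      "skew4 k e (kummer 0 2 0 0) (kummer 0 0 0 0) = 2 * otheta k e 0 1 0 0 * otheta k e 0 1 0 0"
      unfolding O[OF e] by (simp_all add: od0[OF e] power2_eq_square)
  qed (unfold E.D_y0 E.D_y11 E.D_y12 E.D_y22 E.D_x1 E.D_x2 E.D_x1y11 E.D_x1y12 E.D_x1y22 E.D_x2y11 E.D_x2y12 E.D_x2y22,
       use Knz a u in \<open>simp_all add: power2_eq_square\<close>)
qed

end

section \<open>The Wronskian under duplication\<close>

text \<open>Addition of the class n in the group of half-integral modulo integral vectors, acting on
  the indices.\<close>

definition xor_shift :: "nat \<Rightarrow> (nat \<Rightarrow> complex) \<Rightarrow> nat \<Rightarrow> complex" where
  "xor_shift n v i = v (if n = 0 then i else if n = 1 then (if i = 0 then 1 else if i = 1 then 0 else if i = 2 then 3 else 2)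
     else if n = 2 then (if i = 0 then 2 else if i = 1 then 3 else if i = 2 then 0 else 1)
     else (if i = 0 then 3 else if i = 1 then 2 else if i = 2 then 1 else 0))"

text \<open>At twice the period matrix and up to the factor 64, this is the determinant of K and its
  second derivatives at 0.\<close>

definition wronskian :: "complex \<Rightarrow> complex \<Rightarrow> complex \<Rightarrow> complex" where
  "wronskian p q r = det4 (\<lambda>i. theta2 (half1 i) (half2 i) 0 0 p q r 0 0) (\<lambda>i. theta2 (half1 i) (half2 i) 2 0 p q r 0 0)
     (\<lambda>i. theta2 (half1 i) (half2 i) 1 1 p q r 0 0) (\<lambda>i. theta2 (half1 i) (half2 i) 0 2 p q r 0 0)"

text \<open>The ten even theta nulls are split by the upper characteristic, zero here and nonzero in
  \<open>null6\<close>, because the two products duplicate differently.\<close>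

definition null4 :: "complex \<Rightarrow> complex \<Rightarrow> complex \<Rightarrow> complex" where
  "null4 p q r = theta2 0 0 0 0 p q r 0 0 * theta2 0 0 0 0 p q r (1/2) 0 * theta2 0 0 0 0 p q r 0 (1/2) * theta2 0 0 0 0 p q r (1/2) (1/2)"

definition null6 :: "complex \<Rightarrow> complex \<Rightarrow> complex \<Rightarrow> complex" where
  "null6 p q r = theta2 (1/2) 0 0 0 p q r 0 0 * theta2 (1/2) 0 0 0 p q r 0 (1/2) *
     (theta2 0 (1/2) 0 0 p q r 0 0 * theta2 0 (1/2) 0 0 p q r (1/2) 0) *
     (theta2 (1/2) (1/2) 0 0 p q r 0 0 * theta2 (1/2) (1/2) 0 0 p q r (1/2) (1/2))"

lemma double_half12_Ints [simp]: "2 * half1 i \<in> \<int>" "2 * half2 i \<in> \<int>"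
  by (auto simp: half1_def half2_def)

lemma half_Ints: "a \<in> {0, 1/2 :: real} \<Longrightarrow> 2 * a \<in> \<int>"
proof -
  assume "a \<in> {0, 1/2}"
  then have "2 * a = 0 \<or> 2 * a = 1" by auto
  then show ?thesis by (metis Ints_0 Ints_1)
qed

lemma det4_scale: "det4 (\<lambda>i. f i * x i) (\<lambda>i. f i * y i) (\<lambda>i. f i * z i) (\<lambda>i. f i * w i) = f 0 * f 1 * f 2 * f 3 * det4 x y z w"
  unfolding det4_def minor4_def by algebra

context siegel_point
begin

lemma half_add:
  assumes "n \<in> {0, 1, 2, 3}"
  shows "theta2 (half1 n) (half2 n) 0 0 p q r (x1 + y1) (x2 + y2) * theta2 (half1 n) (half2 n) 0 0 p q r (x1 - y1) (x2 - y2) =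
    dot4 (xor_shift n (kummer 0 0 x1 x2)) (kummer 0 0 y1 y2)"
  unfolding theta2_add[OF pd cpos] sum_bits using assms
  by (auto simp: dot4_def xor_shift_def kummer_def)

lemma half_addition_formula:
  assumes "n \<in> {0, 1, 2, 3}"
  shows "addition_formula (\<lambda>j k. theta2 (half1 n) (half2 n) j k p q r) (\<lambda>i j k l x1 x2 y1 y2. dot4 (xor_shift n (kummer i j x1 x2)) (kummer k l y1 y2))"
  by unfold_locales (auto simp: dot4_def xor_shift_def half_add[OF assms, unfolded dot4_def xor_shift_def]
      intro!: derivative_eq_intros kummer_deriv1 kummer_deriv2 theta2_deriv1[OF pd cpos] theta2_deriv2[OF pd cpos])

lemma half_odd_zero: "odd (j + k) \<Longrightarrow> theta2 (half1 n) (half2 n) j k p q r 0 0 = 0"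
  using theta2_uminus[of "half1 n" "half2 n" j k p q r 0 0] by simp

text \<open>The Taylor coefficients in y at x = 0 factor the matrix at \<open>\<tau>\<close>, scaled
  by nulls, into the matrix at \<open>2\<tau>\<close> and the matrix C; each row of second
  derivatives contributes a factor 2, whence 8. C is a group matrix of the four-group, so its
  determinant is the product of the four character sums, and by \<open>theta2_parity\<close> these
  are the nulls at \<open>\<tau>/2\<close> with a = 0.\<close>

lemma wronskian_double: "wronskian p q r * (theta2 0 0 0 0 p q r 0 0 * theta2 (1/2) 0 0 0 p q r 0 0 * theta2 0 (1/2) 0 0 p q r 0 0 * theta2 (1/2) (1/2) 0 0 p q r 0 0)
   = 8 * null4 (p / 2) (q / 2) (r / 2) * wronskian (2 * p) (2 * q) (2 * r)"
proof -
  define Q where "Q = (\<lambda>j k i. theta2 (half1 i) (half2 i) j k (2 * p) (2 * q) (2 * r) 0 0)"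
  define f where "f = (\<lambda>j k i. theta2 (half1 i) (half2 i) j k p q r 0 0)"
  define C where "C = (\<lambda>i. xor_shift i (Q 0 0))"
  have kummer: "kummer j k 0 0 = (\<lambda>i. 2 ^ (j + k) * Q j k i)" for j k
    by (auto simp: kummer_def Q_def)
  have C: "xor_shift n (kummer 0 0 0 0) = C n" for n
    by (auto simp: C_def xor_shift_def kummer)
  have d: "dot4 x (\<lambda>i. a * y i) = a * dot4 x y" for a x y
    by (simp add: dot4_def algebra_simps)
  have *: "f 0 0 n * f 0 0 n = dot4 (Q 0 0) (C n)" "f 0 0 n * f 2 0 n = 2 * dot4 (Q 2 0) (C n)"
      "f 0 0 n * f 1 1 n = 2 * dot4 (Q 1 1) (C n)" "f 0 0 n * f 0 2 n = 2 * dot4 (Q 0 2) (C n)" if n: "n \<in> {0, 1, 2, 3}" for n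
  proof -
    note J = half_addition_formula[OF n]
    have z: "theta2 (half1 n) (half2 n) 1 0 p q r 0 0 = 0" "theta2 (half1 n) (half2 n) 0 1 p q r 0 0 = 0"
      by (simp_all add: half_odd_zero)
    show "f 0 0 n * f 0 0 n = dot4 (Q 0 0) (C n)"
      using addition_formula.D_y0[OF J, of 0 0] unfolding C unfolding kummer d by (simp add: f_def dot4_commute)
    show "f 0 0 n * f 2 0 n = 2 * dot4 (Q 2 0) (C n)"
      using addition_formula.D_y11[OF J, of 0 0] unfolding C z unfolding kummer d by (simp add: f_def dot4_commute)
    show "f 0 0 n * f 1 1 n = 2 * dot4 (Q 1 1) (C n)"
      using addition_formula.D_y12[OF J, of 0 0] unfolding C z unfolding kummer d by (simp add: f_def dot4_commute)
    show "f 0 0 n * f 0 2 n = 2 * dot4 (Q 0 2) (C n)"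
      using addition_formula.D_y22[OF J, of 0 0] unfolding C z unfolding kummer d by (simp add: f_def dot4_commute)
  qed
  have "f 0 0 0 * f 0 0 1 * f 0 0 2 * f 0 0 3 * det4 (f 0 0) (f 2 0) (f 1 1) (f 0 2)
     = det4 (\<lambda>i. f 0 0 i * f 0 0 i) (\<lambda>i. f 0 0 i * f 2 0 i) (\<lambda>i. f 0 0 i * f 1 1 i) (\<lambda>i. f 0 0 i * f 0 2 i)"
    by (rule det4_scale[symmetric])
  also have "\<dots> = 8 * det4 (\<lambda>i. dot4 (Q 0 0) (C i)) (\<lambda>i. dot4 (Q 2 0) (C i)) (\<lambda>i. dot4 (Q 1 1) (C i)) (\<lambda>i. dot4 (Q 0 2) (C i))"
    unfolding det4_def minor4_def *[OF insertI1] *[OF insertI2[OF insertI1]] *[OF insertI2[OF insertI2[OF insertI1]]]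
      *[OF insertI2[OF insertI2[OF insertI2[OF insertI1]]]] by algebra
  also have "\<dots> = 8 * (det4 (Q 0 0) (Q 2 0) (Q 1 1) (Q 0 2) * det4 (C 0) (C 1) (C 2) (C 3))"
    unfolding det4_mult ..
  also have "det4 (C 0) (C 1) (C 2) (C 3) = null4 (p / 2) (q / 2) (r / 2)"
  proof -
    have pd': "im_ge (c / 2) (p / 2) (q / 2) (r / 2)" "c / 2 > 0"
      using im_ge_scale[OF pd, of "1/2"] cpos by simp_all
    have e: "4 * (x / 2) = 2 * x" "2 * (1 / 2) = 0 + (1 :: complex)" for x :: complex by simp_all
    have "null4 (p / 2) (q / 2) (r / 2) = (Q 0 0 0 + Q 0 0 1 + Q 0 0 2 + Q 0 0 3) * (Q 0 0 0 - Q 0 0 1 + Q 0 0 2 - Q 0 0 3)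
      * (Q 0 0 0 + Q 0 0 1 - Q 0 0 2 - Q 0 0 3) * (Q 0 0 0 - Q 0 0 1 - Q 0 0 2 + Q 0 0 3)"
      unfolding null4_def theta2_parity[OF pd'] sum_bits e theta2_period1 theta2_period2
      by (simp add: Q_def) algebra
    also have "\<dots> = det4 (C 0) (C 1) (C 2) (C 3)"
      unfolding det4_def minor4_def C_def xor_shift_def by simp algebra
    finally show ?thesis by simp
  qed
  finally show ?thesis
    unfolding wronskian_def by (simp add: f_def Q_def mult_ac)
qed

text \<open>The six odd theta nulls: the values at b and -b are related by reflection and by an
  integral period, with opposite signs.\<close>

lemma theta2_half_zero:
  assumes "a \<in> {0, 1/2}"
  shows "theta2 a (1/2) 0 0 p q r 0 (1/2) = 0" "theta2 (1/2) a 0 0 p q r (1/2) 0 = 0"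
    "theta2 (1/2) 0 0 0 p q r (1/2) (1/2) = 0" "theta2 0 (1/2) 0 0 p q r (1/2) (1/2) = 0"
proof -
  have i: "2 * a \<in> \<int>" "2 * (1/2 :: real) \<in> \<int>" "2 * (0::real) \<in> \<int>" using half_Ints[OF assms] by auto
  have e: "- (1/2) + 1 = (1/2 :: complex)" by simp
  show "theta2 a (1/2) 0 0 p q r 0 (1/2) = 0"
    using theta2_period2[of a "1/2" 0 0 p q r 0 "- (1/2)"] theta2_uminus[OF i(1,2), of 0 0 p q r 0 "1/2"] e by simp
  show "theta2 (1/2) a 0 0 p q r (1/2) 0 = 0"
    using theta2_period1[of "1/2" a 0 0 p q r "- (1/2)" 0] theta2_uminus[OF i(2,1), of 0 0 p q r "1/2" 0] e by simp
  show "theta2 (1/2) 0 0 0 p q r (1/2) (1/2) = 0"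
    using theta2_period1[of "1/2" 0 0 0 p q r "- (1/2)" "1/2"] theta2_period2[of "1/2" 0 0 0 p q r "- (1/2)" "- (1/2)"]
      theta2_uminus[OF i(2,3), of 0 0 p q r "1/2" "1/2"] e by simp
  show "theta2 0 (1/2) 0 0 p q r (1/2) (1/2) = 0"
    using theta2_period1[of 0 "1/2" 0 0 p q r "- (1/2)" "1/2"] theta2_period2[of 0 "1/2" 0 0 p q r "- (1/2)" "- (1/2)"]
      theta2_uminus[OF i(3,2), of 0 0 p q r "1/2" "1/2"] e by simp
qed

end

context siegel_point
begin

text \<open>The addition theorem with x = b/2 and y = -b/2 expresses the product of the nulls at 0
  and b. Of its four summands two contain odd nulls and vanish, the other two agree.\<close>

lemma null6_double:
  "null6 p q r = 8 * (theta2 (1/2) 0 0 0 (2*p) (2*q) (2*r) 0 (1/2) * theta2 0 (1/2) 0 0 (2*p) (2*q) (2*r) (1/2) 0 * theta2 (1/2) (1/2) 0 0 (2*p) (2*q) (2*r) (1/2) (1/2))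
     * (theta2 0 0 0 0 (2*p) (2*q) (2*r) (1/2) 0 * theta2 0 0 0 0 (2*p) (2*q) (2*r) 0 (1/2) * theta2 0 0 0 0 (2*p) (2*q) (2*r) (1/2) (1/2))"
proof -
  interpret D: siegel_point "2 * p" "2 * q" "2 * r" "2 * c"
    using im_ge2 by unfold_locales
  note z = D.theta2_half_zero[of 0, simplified] D.theta2_half_zero[of "1/2", simplified]
  have m: "theta2 a b 0 0 (2*p) (2*q) (2*r) (- x) (- y) = theta2 a b 0 0 (2*p) (2*q) (2*r) x y"
    if "a \<in> {0, 1/2}" "b \<in> {0, 1/2}" for a b x y
    using theta2_uminus[OF half_Ints half_Ints, OF that, of 0 0 "2*p" "2*q" "2*r" x y] by simp
  have m': "theta2 a b 0 0 (2*p) (2*q) (2*r) (- x) 0 = theta2 a b 0 0 (2*p) (2*q) (2*r) x 0"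
    "theta2 a b 0 0 (2*p) (2*q) (2*r) 0 (- x) = theta2 a b 0 0 (2*p) (2*q) (2*r) 0 x"
    if "a \<in> {0, 1/2}" "b \<in> {0, 1/2}" for a b x
    using m[OF that, of x 0] m[OF that, of 0 x] by simp_all
  have 1: "theta2 (1/2) 0 0 0 p q r 0 0 * theta2 (1/2) 0 0 0 p q r 0 (1/2) =
      2 * theta2 (1/2) 0 0 0 (2*p) (2*q) (2*r) 0 (1/2) * theta2 0 0 0 0 (2*p) (2*q) (2*r) 0 (1/2)"
    using theta2_add[OF pd cpos, of "1/2" 0 0 0 "1/4" "- (1/4)"] unfolding sum_bits
    by (simp add: z m m')
  have 2: "theta2 0 (1/2) 0 0 p q r 0 0 * theta2 0 (1/2) 0 0 p q r (1/2) 0 =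
      2 * theta2 0 (1/2) 0 0 (2*p) (2*q) (2*r) (1/2) 0 * theta2 0 0 0 0 (2*p) (2*q) (2*r) (1/2) 0"
    using theta2_add[OF pd cpos, of 0 "1/2" "1/4" "- (1/4)" 0 0] unfolding sum_bits
    by (simp add: z m m')
  have 3: "theta2 (1/2) (1/2) 0 0 p q r 0 0 * theta2 (1/2) (1/2) 0 0 p q r (1/2) (1/2) =
      2 * theta2 (1/2) (1/2) 0 0 (2*p) (2*q) (2*r) (1/2) (1/2) * theta2 0 0 0 0 (2*p) (2*q) (2*r) (1/2) (1/2)"
    using theta2_add[OF pd cpos, of "1/2" "1/2" "1/4" "- (1/4)" "1/4" "- (1/4)"] unfolding sum_bits
    by (simp add: z m m')
  show ?thesis unfolding null6_def 1 2 3 by algebra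
qed

end

section \<open>Leading terms\<close>

text \<open>The indices of the shortest vector of the class and of its negative. For i = 0 they
  coincide, so that the leading coefficient is 1 there, while the other classes have two
  terms.\<close>

definition min_points :: "nat \<Rightarrow> (int \<times> int) set" where
  "min_points i = {(0, 0), (if half1 i = 0 then 0 else -1, if half2 i = 0 then 0 else -1)}"

definition leading_summand :: "nat \<Rightarrow> nat \<Rightarrow> nat \<Rightarrow> complex \<Rightarrow> complex \<Rightarrow> int \<times> int \<Rightarrow> complex" where
  "leading_summand i j k z w = (\<lambda>(m, n). (2 * of_real pi * \<i> * of_real (of_int m + half1 i)) ^ j * (2 * of_real pi * \<i> * of_real (of_int n + half2 i)) ^ k *
     exp (2 * of_real pi * \<i> * (of_real (of_int m + half1 i) * z + of_real (of_int n + half2 i) * w)))"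

definition leading :: "nat \<Rightarrow> nat \<Rightarrow> nat \<Rightarrow> complex \<Rightarrow> complex \<Rightarrow> complex" where
  "leading i j k z w = (\<Sum>mn\<in>min_points i. leading_summand i j k z w mn)"

definition lead_exp :: "nat \<Rightarrow> complex \<Rightarrow> complex \<Rightarrow> complex \<Rightarrow> complex" where
  "lead_exp i p q r = exp (of_real pi * \<i> * (p * of_real ((half1 i)\<^sup>2) + 2 * q * of_real (half1 i * half2 i) + r * of_real ((half2 i)\<^sup>2)))"

text \<open>The class minimum is attained only at \<open>min_points\<close>, with a margin
  proportional to the squared length. Multiplying the period matrix by 2^n multiplies t by
  2^n.\<close>

definition gap_ge :: "real \<Rightarrow> complex \<Rightarrow> complex \<Rightarrow> complex \<Rightarrow> bool" where
  "gap_ge t p q r \<longleftrightarrow> (\<forall>i\<in>{0, 1, 2, 3}. \<forall>m n. (m, n) \<notin> min_points i \<longrightarrow>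
     qform (Im p) (Im q) (Im r) (of_int m + half1 i) (of_int n + half2 i) - qform (Im p) (Im q) (Im r) (half1 i) (half2 i)
       \<ge> t * ((of_int m + half1 i)\<^sup>2 + (of_int n + half2 i)\<^sup>2))"

text \<open>Here c = 1 is the part of the gap reserved for summability, and R = 0 because z and w
  are real in the estimate.\<close>

definition tail_const :: "nat \<Rightarrow> nat \<Rightarrow> nat \<Rightarrow> real" where
  "tail_const i j k = (\<Sum>\<^sub>\<infinity>(m, n). theta_majorant 1 0 j (half1 i) m * theta_majorant 1 0 k (half2 i) n)"

lemma tail_const_nonneg: "tail_const i j k \<ge> 0"
  unfolding tail_const_def by (rule infsum_nonneg) (auto simp: theta_majorant_nonneg)

lemma nonmin_norm_ge:
  assumes "i \<in> {0, 1, 2, 3}" "(m, n) \<notin> min_points i"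
  shows "(of_int m + half1 i)\<^sup>2 + (of_int n + half2 i)\<^sup>2 \<ge> 1/4"
proof -
  have h: "(of_int x + 1/2)\<^sup>2 \<ge> (1/4 :: real)" for x :: int
  proof -
    have "0 \<le> x * (x + 1)" by (cases "x \<ge> 0") (auto intro: mult_nonpos_nonpos)
    then have "0 \<le> (of_int (x * (x + 1)) :: real)" by (simp only: of_int_0_le_iff)
    then show ?thesis by (simp add: power2_eq_square algebra_simps)
  qed
  have o: "(of_int x)\<^sup>2 \<ge> (1::real)" if "x \<noteq> 0" for x :: int
    using that by (metis of_int_1 of_int_le_iff of_int_power zero_less_power2 int_one_le_iff_zero_less)
  consider "i = 0" | "half1 i = 1/2" | "half2 i = 1/2" using assms(1) by auto
  then show ?thesis
  proof cases
    case 1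
    then have "m \<noteq> 0 \<or> n \<noteq> 0" using assms by (auto simp: min_points_def)
    then show ?thesis using 1 o[of m] o[of n] by (auto intro: add_increasing add_increasing2)
  next
    case 2
    show ?thesis using h[of m] unfolding 2 by (simp add: add_increasing2)
  next
    case 3
    show ?thesis using h[of n] unfolding 3 by (simp add: add_increasing)
  qed
qed

lemma finite_min_points [simp]: "finite (min_points i)" by (simp add: min_points_def)

lemma theta_term_min_points:
  assumes "mn \<in> min_points i"
  shows "theta_term (half1 i) (half2 i) j k p q r z w mn = lead_exp i p q r * leading_summand i j k z w mn"
proof (cases mn)
  case (Pair m n)
  have "(of_int m + half1 i = half1 i \<and> of_int n + half2 i = half2 i) \<or> (of_int m + half1 i = - half1 i \<and> of_int n + half2 i = - half2 i)"
    using assms by (auto simp: Pair min_points_def half1_def half2_def)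
  then have e: "(of_int m + half1 i)\<^sup>2 = (half1 i)\<^sup>2" "(of_int n + half2 i)\<^sup>2 = (half2 i)\<^sup>2" "(of_int m + half1 i) * (of_int n + half2 i) = half1 i * half2 i"
    by (elim disjE conjE; simp only: power2_minus minus_mult_minus)+
  show ?thesis
    unfolding Pair theta_term_def leading_summand_def lead_exp_def prod.case e exp_add by (simp only: mult_ac)
qed

lemma lead_exp_nonzero [simp]: "lead_exp i p q r \<noteq> 0" by (simp add: lead_exp_def)

lemma norm_lead_exp: "norm (lead_exp i p q r) = exp (- pi * qform (Im p) (Im q) (Im r) (half1 i) (half2 i))"
  unfolding lead_exp_def norm_exp_eq_Re qform_def by (simp add: power2_eq_square algebra_simps)

text \<open>Outside \<open>min_points\<close> the gap t |x|^2 is split as |x|^2 + (t - 1) |x|^2. The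
  first part makes the tail summable; in the second, |x|^2 is at least 1/4, which gives the
  exponential factor.\<close>

lemma leading_estimate:
  assumes i: "i \<in> {0, 1, 2, 3}" and pd: "im_ge c p q r" "c > 0" and d: "gap_ge t p q r" and t: "t \<ge> 1"
    and zw: "Im z = 0" "Im w = 0"
  shows "norm (theta2 (half1 i) (half2 i) j k p q r z w / lead_exp i p q r - leading i j k z w) \<le> tail_const i j k * exp (- pi * (t - 1) / 4)"
proof -
  define f where "f = theta_term (half1 i) (half2 i) j k p q r z w"
  define X where "X = exp (- pi * (t - 1) / 4)"
  define g where "g = (\<lambda>mn. case mn of (m, n) \<Rightarrow> theta_majorant 1 0 j (half1 i) m * theta_majorant 1 0 k (half2 i) n)"
  have f: "f summable_on UNIV" unfolding f_def by (rule summable_theta_term[OF pd])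
  have f': "f summable_on A" for A by (rule summable_on_subset_banach[OF f]) simp
  have g: "g summable_on UNIV" unfolding g_def by (rule summable_theta_majorant2) simp
  have g': "g summable_on A" for A by (rule summable_on_subset_banach[OF g]) simp
  have gnn: "g x \<ge> 0" for x by (auto simp: g_def theta_majorant_nonneg split: prod.split)
  have "infsum f UNIV = infsum f (min_points i \<union> - min_points i)" by simp
  also have "\<dots> = infsum f (min_points i) + infsum f (- min_points i)"
    by (rule infsum_Un_disjoint[OF f' f']) auto
  also have "infsum f (min_points i) = (\<Sum>mn\<in>min_points i. lead_exp i p q r * leading_summand i j k z w mn)"
    unfolding infsum_finite[OF finite_min_points] f_def by (intro sum.cong refl theta_term_min_points)
  also have "\<dots> = lead_exp i p q r * leading i j k z w"
    by (simp add: leading_def sum_distrib_left)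
  finally have "theta2 (half1 i) (half2 i) j k p q r z w / lead_exp i p q r - leading i j k z w = infsum f (- min_points i) / lead_exp i p q r"
    by (simp add: theta2_def f_def add_divide_distrib)
  also have "norm \<dots> \<le> tail_const i j k * X"
  proof -
    have "norm (infsum f (- min_points i)) \<le> infsum (\<lambda>mn. norm (lead_exp i p q r) * X * g mn) (- min_points i)"
    proof (rule norm_infsum_le[OF has_sum_infsum[OF f'] has_sum_infsum])
      show "(\<lambda>mn. norm (lead_exp i p q r) * X * g mn) summable_on - min_points i"
        by (intro summable_on_cmult_right g')
      fix mn assume mn: "mn \<in> - min_points i"
      obtain m n where Pair: "mn = (m, n)" by (cases mn)
      define u v where "u = of_int m + half1 i" and "v = of_int n + half2 i"
      have nm: "(m, n) \<notin> min_points i" using mn Pair by simp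
      have 1: "qform (Im p) (Im q) (Im r) u v - qform (Im p) (Im q) (Im r) (half1 i) (half2 i) \<ge> t * (u\<^sup>2 + v\<^sup>2)"
        using d i nm unfolding gap_ge_def u_def v_def by blast
      have "u\<^sup>2 + v\<^sup>2 \<ge> 1/4"
        using nonmin_norm_ge[OF i nm] by (simp add: u_def v_def)
      then have "(t - 1) * (1/4) \<le> (t - 1) * (u\<^sup>2 + v\<^sup>2)"
        using t by (intro mult_left_mono) auto
      with 1 have "qform (Im p) (Im q) (Im r) u v \<ge> qform (Im p) (Im q) (Im r) (half1 i) (half2 i) + (t - 1) / 4 + (u\<^sup>2 + v\<^sup>2)"
        by (simp add: algebra_simps)
      then have "pi * (qform (Im p) (Im q) (Im r) (half1 i) (half2 i) + (t - 1) / 4 + (u\<^sup>2 + v\<^sup>2)) \<le> pi * qform (Im p) (Im q) (Im r) u v"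
        by (intro mult_left_mono) auto
      then have "exp (- pi * qform (Im p) (Im q) (Im r) u v) \<le>
          exp (- pi * qform (Im p) (Im q) (Im r) (half1 i) (half2 i) + - pi * (t - 1) / 4 + (- pi * u\<^sup>2 + - pi * v\<^sup>2))"
        unfolding exp_le_cancel_iff by (simp add: field_simps)
      also have "\<dots> = norm (lead_exp i p q r) * X * (exp (- pi * u\<^sup>2) * exp (- pi * v\<^sup>2))"
        unfolding exp_add norm_lead_exp X_def ..
      finally have 2: "exp (- pi * qform (Im p) (Im q) (Im r) u v) \<le> norm (lead_exp i p q r) * X * (exp (- pi * u\<^sup>2) * exp (- pi * v\<^sup>2))" .
      have "norm (f mn) = (2 * pi * \<bar>u\<bar>) ^ j * (2 * pi * \<bar>v\<bar>) ^ k * exp (- pi * qform (Im p) (Im q) (Im r) u v)"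
        unfolding f_def Pair norm_theta_term u_def v_def by (simp add: zw)
      also have "\<dots> \<le> (2 * pi * \<bar>u\<bar>) ^ j * (2 * pi * \<bar>v\<bar>) ^ k * (norm (lead_exp i p q r) * X * (exp (- pi * u\<^sup>2) * exp (- pi * v\<^sup>2)))"
        by (rule mult_left_mono[OF 2]) simp
      also have "\<dots> = norm (lead_exp i p q r) * X * g mn"
        unfolding g_def Pair prod.case theta_majorant_def u_def[symmetric] v_def[symmetric] by (simp add: mult_ac)
      finally show "norm (f mn) \<le> norm (lead_exp i p q r) * X * g mn" .
    qed
    also have "\<dots> = norm (lead_exp i p q r) * X * infsum g (- min_points i)"
      by (rule infsum_cmult_right') 
    also have "\<dots> \<le> norm (lead_exp i p q r) * X * tail_const i j k"
    proof (rule mult_left_mono)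
      show "infsum g (- min_points i) \<le> tail_const i j k"
        unfolding tail_const_def g_def[symmetric] by (rule infsum_mono_neutral[OF g' g]) (auto simp: gnn)
    qed (simp add: X_def)
    finally show ?thesis
      by (simp add: norm_divide pos_divide_le_eq mult_ac)
  qed
  finally show ?thesis by (simp add: X_def)
qed

lemma gap_ge_scale:
  assumes "gap_ge t p q r" "s \<ge> 0"
  shows "gap_ge (s * t) (of_real s * p) (of_real s * q) (of_real s * r)"
  unfolding gap_ge_def
proof (intro ballI allI impI)
  fix i m n assume i: "i \<in> {0, 1, 2, 3::nat}" "(m, n) \<notin> min_points i"
  let ?u = "of_int m + half1 i" and ?v = "of_int n + half2 i"
  have "t * (?u\<^sup>2 + ?v\<^sup>2) \<le> qform (Im p) (Im q) (Im r) ?u ?v - qform (Im p) (Im q) (Im r) (half1 i) (half2 i)"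
    using assms i unfolding gap_ge_def by blast
  from mult_left_mono[OF this assms(2)]
  show "s * t * (?u\<^sup>2 + ?v\<^sup>2) \<le> qform (Im (of_real s * p)) (Im (of_real s * q)) (Im (of_real s * r)) ?u ?v
     - qform (Im (of_real s * p)) (Im (of_real s * q)) (Im (of_real s * r)) (half1 i) (half2 i)"
    by (simp add: qform_def algebra_simps)
qed

definition ntheta :: "nat \<Rightarrow> nat \<Rightarrow> nat \<Rightarrow> complex \<Rightarrow> complex \<Rightarrow> complex \<Rightarrow> complex \<Rightarrow> complex \<Rightarrow> complex" where
  "ntheta i j k p q r z w = theta2 (half1 i) (half2 i) j k p q r z w / lead_exp i p q r"

lemma leading_limit:
  assumes i: "i \<in> {0, 1, 2, 3}" and pd: "im_ge c p q r" "c > 0" and d: "gap_ge t p q r" and t: "t \<ge> 1"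
    and zw: "Im z = 0" "Im w = 0"
  shows "(\<lambda>n. ntheta i j k (2 ^ n * p) (2 ^ n * q) (2 ^ n * r) z w) \<longlonglongrightarrow> leading i j k z w"
proof (rule LIM_zero_cancel, rule Lim_null_comparison)
  show "\<forall>\<^sub>F n in sequentially. norm (ntheta i j k (2 ^ n * p) (2 ^ n * q) (2 ^ n * r) z w - leading i j k z w) \<le> tail_const i j k * exp (- pi / 4) ^ n"
  proof (intro always_eventually allI)
    fix n
    have 1: "im_ge (2 ^ n * c) (2 ^ n * p) (2 ^ n * q) (2 ^ n * r)"
      using im_ge_scale[OF pd(1), of "2 ^ n"] by simp
    have 2: "gap_ge (2 ^ n * t) (2 ^ n * p) (2 ^ n * q) (2 ^ n * r)"
      using gap_ge_scale[OF d, of "2 ^ n"] by simp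
    have "real n + 1 \<le> 2 ^ n" by (induction n) auto
    also have "\<dots> \<le> 2 ^ n * t" using t by simp
    finally have 3: "real n + 1 \<le> 2 ^ n * t" .
    then have "pi * real n \<le> pi * (2 ^ n * t - 1)" by (intro mult_left_mono) auto
    then have "exp (- pi * (2 ^ n * t - 1) / 4) \<le> exp (real n * (- pi / 4))" by simp
    then have 4: "tail_const i j k * exp (- pi * (2 ^ n * t - 1) / 4) \<le> tail_const i j k * exp (- pi / 4) ^ n"
      unfolding exp_of_nat_mult by (rule mult_left_mono[OF _ tail_const_nonneg])
    show "norm (ntheta i j k (2 ^ n * p) (2 ^ n * q) (2 ^ n * r) z w - leading i j k z w) \<le> tail_const i j k * exp (- pi / 4) ^ n"
      unfolding ntheta_def
      by (rule order_trans[OF leading_estimate[OF i 1 _ 2 _ zw] 4]) (use 3 pd in auto)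
  qed
  have "(\<lambda>n. exp (- pi / 4) ^ n) \<longlonglongrightarrow> 0" by (rule LIMSEQ_power_zero) simp
  then show "(\<lambda>n. tail_const i j k * exp (- pi / 4) ^ n) \<longlonglongrightarrow> 0"
    by (rule tendsto_mult_right_zero)
qed

lemma exp_pi_half:
  "exp (2 * of_real pi * \<i> * (1/4 + 1/4)) = (-1 :: complex)" "exp (2 * of_real pi * \<i> * (- (1/4) - 1/4)) = (-1 :: complex)"
proof -
  have "2 * of_real pi * \<i> * (1/4 + 1/4) = \<i> * of_real pi" "2 * of_real pi * \<i> * (- (1/4) - 1/4) = - (\<i> * of_real pi)" by simp_all
  then show "exp (2 * of_real pi * \<i> * (1/4 + 1/4)) = (-1 :: complex)" "exp (2 * of_real pi * \<i> * (- (1/4) - 1/4)) = (-1 :: complex)"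
    by (simp_all only: exp_pi_i' exp_minus) simp
qed

lemma leading_values:
  "leading 0 0 0 z w = 1" "leading 0 2 0 z w = 0" "leading 0 1 1 z w = 0" "leading 0 0 2 z w = 0"
  "leading 1 0 0 0 0 = 2" "leading 2 0 0 0 0 = 2" "leading 3 0 0 0 0 = 2"
  "leading 1 0 0 0 (1/2) = 2" "leading 2 0 0 (1/2) 0 = 2" "leading 3 0 0 (1/2) (1/2) = -2"
  "leading 1 2 0 0 0 = - 2 * of_real pi ^ 2" "leading 1 1 1 0 0 = 0" "leading 1 0 2 0 0 = 0"
  "leading 2 2 0 0 0 = 0" "leading 2 1 1 0 0 = 0" "leading 2 0 2 0 0 = - 2 * of_real pi ^ 2"
  "leading 3 2 0 0 0 = - 2 * of_real pi ^ 2" "leading 3 1 1 0 0 = - 2 * of_real pi ^ 2" "leading 3 0 2 0 0 = - 2 * of_real pi ^ 2"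
  using exp_pi_half
  by (simp_all add: leading_def min_points_def leading_summand_def power2_eq_square field_simps)

lemma theta_null_nonzero:
  obtains t1 where "t1 \<ge> 1"
    "\<And>t p q r c i z w. t \<ge> t1 \<Longrightarrow> im_ge c p q r \<Longrightarrow> c > 0 \<Longrightarrow> gap_ge t p q r \<Longrightarrow> i \<in> {0, 1, 2, 3} \<Longrightarrow> Im z = 0 \<Longrightarrow> Im w = 0 \<Longrightarrow>
       norm (leading i 0 0 z w) \<ge> 1 \<Longrightarrow> theta2 (half1 i) (half2 i) 0 0 p q r z w \<noteq> 0"
proof
  define C where "C = tail_const 0 0 0 + tail_const 1 0 0 + tail_const 2 0 0 + tail_const 3 0 0"
  have C: "tail_const i 0 0 \<le> C" if "i \<in> {0, 1, 2, 3}" for i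
    using that tail_const_nonneg[of 0 0 0] tail_const_nonneg[of 1 0 0] tail_const_nonneg[of 2 0 0] tail_const_nonneg[of 3 0 0] by (auto simp: C_def)
  have C0: "C \<ge> 0" using C[of 0] tail_const_nonneg[of 0 0 0] by simp
  \<comment> \<open>The factor 8 leaves a margin: the exponential is at least 1 + (t - 1)/4, hence
    at least 1 + 2C, and so exceeds the tail constant.\<close>
  show "1 + 8 * C \<ge> 1" using C0 by simp
  fix t p q r c i z w
  assume t: "t \<ge> 1 + 8 * C" and pd: "im_ge c p q r" "c > 0" and d: "gap_ge t p q r" and i: "i \<in> {0, 1, 2, 3}"
    and zw: "Im z = 0" "Im w = 0" and l: "norm (leading i 0 0 z w) \<ge> 1"
  have t1: "t \<ge> 1" using t C0 by simp
  show "theta2 (half1 i) (half2 i) 0 0 p q r z w \<noteq> 0"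
  proof
    assume "theta2 (half1 i) (half2 i) 0 0 p q r z w = 0"
    then have le: "1 \<le> tail_const i 0 0 * exp (- pi * (t - 1) / 4)"
      using leading_estimate[OF i pd d t1 zw, of 0 0] l by simp
    have "exp (pi * (t - 1) / 4) \<le> tail_const i 0 0"
    proof -
      have "exp (- pi * (t - 1) / 4) = inverse (exp (pi * (t - 1) / 4))"
        by (simp flip: exp_minus)
      with le show ?thesis by (simp add: divide_inverse[symmetric] pos_le_divide_eq)
    qed
    moreover have "1 + pi * (t - 1) / 4 \<le> exp (pi * (t - 1) / 4)" by (rule exp_ge_add_one_self)
    moreover have "1 * (t - 1) \<le> pi * (t - 1)" using t1 pi_gt3 by (intro mult_right_mono) auto
    moreover have False if "e \<le> C'" "1 + y / 4 \<le> e" "1 * (t - 1) \<le> y" "C' \<le> C" for e y C'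
      using that C0 t by (simp add: field_simps)
    ultimately show False using C[OF i] by blast
  qed
qed

section \<open>The limit of the normalized Wronskian\<close>

lemma lead_exp_double: "lead_exp i (2 * p) (2 * q) (2 * r) = lead_exp i p q r * lead_exp i p q r"
  unfolding lead_exp_def exp_add[symmetric] by (simp add: algebra_simps)

lemma lead_exp_0 [simp]: "lead_exp 0 p q r = 1" by (simp add: lead_exp_def)

lemma wronskian_ntheta: "wronskian p q r = lead_exp 1 p q r * lead_exp 2 p q r * lead_exp 3 p q r *
   det4 (\<lambda>i. ntheta i 0 0 p q r 0 0) (\<lambda>i. ntheta i 2 0 p q r 0 0) (\<lambda>i. ntheta i 1 1 p q r 0 0) (\<lambda>i. ntheta i 0 2 p q r 0 0)"
  using det4_scale[of "\<lambda>i. lead_exp i p q r" "\<lambda>i. ntheta i 0 0 p q r 0 0" "\<lambda>i. ntheta i 2 0 p q r 0 0" "\<lambda>i. ntheta i 1 1 p q r 0 0" "\<lambda>i. ntheta i 0 2 p q r 0 0"]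
  by (simp add: wronskian_def ntheta_def)

lemma null_ntheta: "null4 p q r = ntheta 0 0 0 p q r 0 0 * ntheta 0 0 0 p q r (1/2) 0 * ntheta 0 0 0 p q r 0 (1/2) * ntheta 0 0 0 p q r (1/2) (1/2)"
  "null6 p q r = (lead_exp 1 p q r * lead_exp 2 p q r * lead_exp 3 p q r)\<^sup>2 *
    (ntheta 1 0 0 p q r 0 0 * ntheta 1 0 0 p q r 0 (1/2) * (ntheta 2 0 0 p q r 0 0 * ntheta 2 0 0 p q r (1/2) 0) * (ntheta 3 0 0 p q r 0 0 * ntheta 3 0 0 p q r (1/2) (1/2)))"
  by (simp_all add: null4_def null6_def ntheta_def power2_eq_square)

text \<open>V is constant in n because the duplication of \<open>wronskian\<close> brings in the
  nulls with b = 0 and \<open>null4\<close>, while that of \<open>null6\<close> brings in the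
  remaining six. The exponentials cancel: \<open>wronskian\<close> at twice the matrix carries each
  \<open>lead_exp\<close> squared, as does \<open>null6\<close>.\<close>

lemma wronskian_domain:
  obtains t1 where "t1 \<ge> 1"
    "\<And>p q r c. im_ge c p q r \<Longrightarrow> c > 0 \<Longrightarrow> gap_ge t1 p q r \<Longrightarrow>
       wronskian (2 * p) (2 * q) (2 * r) = - (of_real pi ^ 6 / 8) * (null4 p q r * null6 p q r)"
proof -
  obtain t1 where t1: "t1 \<ge> 1" and nz: "\<And>t p q r c i z w. t \<ge> t1 \<Longrightarrow> im_ge c p q r \<Longrightarrow> c > 0 \<Longrightarrow> gap_ge t p q r \<Longrightarrow> i \<in> {0, 1, 2, 3} \<Longrightarrow> Im z = 0 \<Longrightarrow> Im w = 0 \<Longrightarrow>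
       norm (leading i 0 0 z w) \<ge> 1 \<Longrightarrow> theta2 (half1 i) (half2 i) 0 0 p q r z w \<noteq> 0"
    using theta_null_nonzero by blast
  have "wronskian (2 * p) (2 * q) (2 * r) = - (of_real pi ^ 6 / 8) * (null4 p q r * null6 p q r)"
    if pd: "im_ge c p q r" "c > 0" and d: "gap_ge t1 p q r" for p q r c
  proof -
    define P where "P = (\<lambda>n. 2 ^ n * p)"
    define Q where "Q = (\<lambda>n. 2 ^ n * q)"
    define R where "R = (\<lambda>n. 2 ^ n * r)"
    have PQR: "2 * P n = P (Suc n)" "2 * Q n = Q (Suc n)" "2 * R n = R (Suc n)" for n
      by (simp_all add: P_def Q_def R_def)
    have pdn: "im_ge (2 ^ n * c) (P n) (Q n) (R n)" "2 ^ n * c > 0" for n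
      using im_ge_scale[OF pd(1), of "2 ^ n"] pd(2) by (simp_all add: P_def Q_def R_def)
    have dn: "gap_ge (2 ^ n * t1) (P n) (Q n) (R n)" for n
      using gap_ge_scale[OF d, of "2 ^ n"] by (simp add: P_def Q_def R_def)
    have tn: "2 ^ n * t1 \<ge> t1" for n using t1 by simp
    note nz' = nz[OF tn pdn dn]
    have nz4: "null4 (P n) (Q n) (R n) \<noteq> 0" for n
      using nz'[of 0] unfolding null4_def by (simp add: leading_values)
    have nz6: "null6 (P n) (Q n) (R n) \<noteq> 0" for n
      using nz'[of 1] nz'[of 2] nz'[of 3] unfolding null6_def by (simp add: leading_values[unfolded One_nat_def])
    define V where "V = (\<lambda>n. wronskian (P (Suc n)) (Q (Suc n)) (R (Suc n)) / (null4 (P n) (Q n) (R n) * null6 (P n) (Q n) (R n)))"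
    have step: "V (Suc n) = V n" for n
    proof -
      interpret A: siegel_point "P n" "Q n" "R n" "2 ^ n * c" using pdn by unfold_locales
      interpret B: siegel_point "P (Suc n)" "Q (Suc n)" "R (Suc n)" "2 ^ Suc n * c" using pdn by unfold_locales
      have h: "P (Suc n) / 2 = P n" "Q (Suc n) / 2 = Q n" "R (Suc n) / 2 = R n" by (simp_all add: P_def Q_def R_def)
      define w2 where "w2 = wronskian (P (Suc n)) (Q (Suc n)) (R (Suc n))"
      define w4 where "w4 = wronskian (P (Suc (Suc n))) (Q (Suc (Suc n))) (R (Suc (Suc n)))"
      define T where "T = (\<lambda>a b. theta2 a b 0 0 (P (Suc n)) (Q (Suc n)) (R (Suc n)))"
      define q where "q = T 0 0 0 0 * T (1/2) 0 0 0 * T 0 (1/2) 0 0 * T (1/2) (1/2) 0 0"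
      define u where "u = T (1/2) 0 0 (1/2) * T 0 (1/2) (1/2) 0 * T (1/2) (1/2) (1/2) (1/2)"
      define v where "v = T 0 0 (1/2) 0 * T 0 0 0 (1/2) * T 0 0 (1/2) (1/2)"
      have 1: "w2 * q = 8 * null4 (P n) (Q n) (R n) * w4"
        using B.wronskian_double unfolding h PQR w2_def[symmetric] w4_def[symmetric] q_def T_def .
      have 2: "null6 (P n) (Q n) (R n) = 8 * u * v"
        using A.null6_double unfolding PQR u_def v_def T_def .
      have 3: "null4 (P (Suc n)) (Q (Suc n)) (R (Suc n)) * null6 (P (Suc n)) (Q (Suc n)) (R (Suc n)) = q * (u * v)"
        unfolding null4_def null6_def q_def u_def v_def T_def by (simp only: mult_ac)
      have "w2 * (q * (u * v)) = (w2 * q) * (u * v)" by (simp only: mult_ac)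
      also have "\<dots> = w4 * (null4 (P n) (Q n) (R n) * null6 (P n) (Q n) (R n))"
        unfolding 1 2 by (simp only: mult_ac)
      finally have "w2 * (null4 (P (Suc n)) (Q (Suc n)) (R (Suc n)) * null6 (P (Suc n)) (Q (Suc n)) (R (Suc n)))
         = w4 * (null4 (P n) (Q n) (R n) * null6 (P n) (Q n) (R n))"
        unfolding 3 .
      note eq = this
      have nzn: "null4 (P n) (Q n) (R n) * null6 (P n) (Q n) (R n) \<noteq> 0" for n
        using nz4[of n] nz6[of n] by (rule no_zero_divisors)
      show ?thesis
        unfolding V_def w2_def[symmetric] w4_def[symmetric] frac_eq_eq[OF nzn nzn] by (rule eq[symmetric])
    qed
    have V0: "V n = V 0" for n by (induction n) (simp_all add: step)
    have lim: "(\<lambda>n. ntheta i j k (P n) (Q n) (R n) z w) \<longlonglongrightarrow> leading i j k z w"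
      if "i \<in> {0, 1, 2, 3}" "Im z = 0" "Im w = 0" for i j k z w
      unfolding P_def Q_def R_def by (rule leading_limit[OF that(1) pd d t1 that(2,3)])
    have lim': "(\<lambda>n. ntheta i j k (P (Suc n)) (Q (Suc n)) (R (Suc n)) z w) \<longlonglongrightarrow> leading i j k z w"
      if "i \<in> {0, 1, 2, 3}" "Im z = 0" "Im w = 0" for i j k z w
      using lim[OF that] by (rule LIMSEQ_Suc)
    have Veq: "V n = det4 (\<lambda>i. ntheta i 0 0 (P (Suc n)) (Q (Suc n)) (R (Suc n)) 0 0) (\<lambda>i. ntheta i 2 0 (P (Suc n)) (Q (Suc n)) (R (Suc n)) 0 0)
        (\<lambda>i. ntheta i 1 1 (P (Suc n)) (Q (Suc n)) (R (Suc n)) 0 0) (\<lambda>i. ntheta i 0 2 (P (Suc n)) (Q (Suc n)) (R (Suc n)) 0 0) /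
        (ntheta 0 0 0 (P n) (Q n) (R n) 0 0 * ntheta 0 0 0 (P n) (Q n) (R n) (1/2) 0 * ntheta 0 0 0 (P n) (Q n) (R n) 0 (1/2) * ntheta 0 0 0 (P n) (Q n) (R n) (1/2) (1/2)
         * (ntheta 1 0 0 (P n) (Q n) (R n) 0 0 * ntheta 1 0 0 (P n) (Q n) (R n) 0 (1/2) * (ntheta 2 0 0 (P n) (Q n) (R n) 0 0 * ntheta 2 0 0 (P n) (Q n) (R n) (1/2) 0)
          * (ntheta 3 0 0 (P n) (Q n) (R n) 0 0 * ntheta 3 0 0 (P n) (Q n) (R n) (1/2) (1/2))))" for n
    proof -
      have c: "(e * e * (f * f) * (g * g) * x) / (y * ((e * f * g)\<^sup>2 * z)) = x / (y * z)"
        if "e \<noteq> 0" "f \<noteq> 0" "g \<noteq> 0" for e f g x y z :: complex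
      proof -
        have "(e * e * (f * f) * (g * g) * x) / (y * ((e * f * g)\<^sup>2 * z)) = ((e * f * g)\<^sup>2 * x) / ((e * f * g)\<^sup>2 * (y * z))"
          by (simp add: power2_eq_square mult_ac)
        then show ?thesis using that by simp
      qed
      show ?thesis
        unfolding V_def null_ntheta wronskian_ntheta PQR[symmetric] lead_exp_double
        by (rule c) simp_all
    qed
    define L where "L = det4 (\<lambda>i. leading i 0 0 0 0) (\<lambda>i. leading i 2 0 0 0) (\<lambda>i. leading i 1 1 0 0) (\<lambda>i. leading i 0 2 0 0) /
        (leading 0 0 0 0 0 * leading 0 0 0 (1/2) 0 * leading 0 0 0 0 (1/2) * leading 0 0 0 (1/2) (1/2)
         * (leading 1 0 0 0 0 * leading 1 0 0 0 (1/2) * (leading 2 0 0 0 0 * leading 2 0 0 (1/2) 0) * (leading 3 0 0 0 0 * leading 3 0 0 (1/2) (1/2))))"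
    \<comment> \<open>The determinant of leading terms is 8 pi^6. The denominator is -64: each of
      the six nulls with nonzero upper characteristic gives 2, except -2 for all entries equal to
      1/2.\<close>
    have Lval: "L = - (of_real pi ^ 6 / 8)"
      unfolding L_def det4_def minor4_def leading_values by (simp add: field_simps)
    have "V \<longlonglongrightarrow> L"
      unfolding Veq L_def det4_def minor4_def
      by (intro tendsto_intros lim lim') (simp_all add: leading_values[unfolded One_nat_def])
    moreover have "V \<longlonglongrightarrow> V 0"
      by (intro tendsto_eventually always_eventually allI V0)
    ultimately have "V 0 = L"
      by (rule LIMSEQ_unique[symmetric])
    then show ?thesis
      using nz4[of 0] nz6[of 0] unfolding Lval V_def by (simp add: P_def Q_def R_def field_simps)
  qed
  with t1 that show ?thesis by blast
qed

section \<open>Evaluation of the Wronskian\<close>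

text \<open>The line in the direction of the form with matrix \<open>(2, -1; -1, 2)\<close> is chosen because this form has, up to sign,
  a unique shortest vector in each class of half-integral vectors.\<close>

lemma hexagonal_ge_3:
  fixes X Y :: int
  assumes "odd X \<or> odd Y" "(X, Y) \<notin> {(1, 0), (-1, 0), (0, 1), (0, -1), (1, 1), (-1, -1)}"
  shows "X\<^sup>2 - X * Y + Y\<^sup>2 \<ge> 3"
proof (rule ccontr)
  assume "\<not> ?thesis"
  then have N: "X\<^sup>2 - X * Y + Y\<^sup>2 \<le> 2" by simp
  have b: "x \<in> {-1, 0, 1}" if "3 * x\<^sup>2 \<le> 8" for x :: int
  proof (rule ccontr)
    assume "x \<notin> {-1, 0, 1}"
    then have "2 \<le> \<bar>x\<bar>" by auto
    then have "2\<^sup>2 \<le> \<bar>x\<bar>\<^sup>2" by (intro power_mono) auto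
    then show False using that by simp
  qed
  \<comment> \<open>Completing the square bounds each coordinate by 1 in absolute value, leaving
    finitely many pairs.\<close>
  have "3 * X\<^sup>2 = 4 * (X\<^sup>2 - X * Y + Y\<^sup>2) - (2 * Y - X)\<^sup>2" "3 * Y\<^sup>2 = 4 * (X\<^sup>2 - X * Y + Y\<^sup>2) - (2 * X - Y)\<^sup>2"
    by algebra+
  note e = this
  have le: "a \<le> 8" if "a = 4 * n - d" "n \<le> 2" "0 \<le> d" for a n d :: int
    using that by linarith
  have "3 * X\<^sup>2 \<le> 8" by (rule le[OF e(1) N zero_le_power2])
  moreover have "3 * Y\<^sup>2 \<le> 8" by (rule le[OF e(2) N zero_le_power2])
  ultimately have "X \<in> {-1, 0, 1}" "Y \<in> {-1, 0, 1}" by (auto dest: b)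
  then show False using assms N by auto
qed

text \<open>For i nonzero put N = X^2 - XY + Y^2. Since X^2 + Y^2 is at most 2N, the constant 2/3
  reduces the claim to N/3 \<le> N/2 - 1/2, that is N \<ge> 3.\<close>

lemma hexagonal_gap:
  assumes i: "i \<in> {0, 1, 2, 3}" and mn: "(m, n) \<notin> min_points i"
  defines "u \<equiv> of_int m + half1 i" and "v \<equiv> of_int n + half2 i"
  shows "qform 2 (-1) 2 u v - qform 2 (-1) 2 (half1 i) (half2 i) \<ge> 2 / 3 * (u\<^sup>2 + v\<^sup>2)"
proof (cases "i = 0")
  case True
  have "qform 2 (-1) 2 u v = (u\<^sup>2 + v\<^sup>2) + (u - v)\<^sup>2"
    unfolding qform_def by algebra
  moreover have "qform 2 (-1) 2 (half1 i) (half2 i) = 0"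
    using True by (simp add: qform_def)
  moreover have "2 / 3 * a \<le> a + b - 0" if "a \<ge> 0" "b \<ge> 0" for a b :: real
    using that by simp
  ultimately show ?thesis by simp
next
  case False
  define X Y :: int where "X = 2 * m + (if half1 i = 0 then 0 else 1)" and "Y = 2 * n + (if half2 i = 0 then 0 else 1)"
  have uv: "u = of_int X / 2" "v = of_int Y / 2"
    using i by (auto simp: u_def v_def X_def Y_def)
  have "X\<^sup>2 - X * Y + Y\<^sup>2 \<ge> 3"
    using i mn False by (intro hexagonal_ge_3) (auto simp: X_def Y_def min_points_def; presburger)+
  then have "(of_int 3 :: real) \<le> of_int (X\<^sup>2 - X * Y + Y\<^sup>2)"
    by (rule of_int_le_iff[THEN iffD2])
  then have N: "(of_int X)\<^sup>2 - of_int X * of_int Y + (of_int Y)\<^sup>2 \<ge> (3 :: real)" by simp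
  have q: "qform 2 (-1) 2 u v = ((of_int X)\<^sup>2 - of_int X * of_int Y + (of_int Y)\<^sup>2) / 2"
    unfolding qform_def uv by (simp add: power2_eq_square field_simps)
  have q0: "qform 2 (-1) 2 (half1 i) (half2 i) = 1 / 2"
    using i False by (auto simp: qform_def power2_eq_square)
  have s: "u\<^sup>2 + v\<^sup>2 = ((of_int X)\<^sup>2 + (of_int Y)\<^sup>2) / 4"
    unfolding uv by (simp add: power2_eq_square field_simps)
  have "0 \<le> (of_int X - of_int Y :: real)\<^sup>2" by simp
  then have A: "0 \<le> (of_int X)\<^sup>2 + (of_int Y)\<^sup>2 - 2 * (of_int X * of_int Y :: real)"
    by (simp add: power2_diff)
  have "2 / 3 * ((a + d) / 4) \<le> (a - b + d) / 2 - 1 / 2" if "0 \<le> a + d - 2 * b" "a - b + d \<ge> 3" for a b d :: real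
    using that by (simp add: field_simps)
  from this[OF A N] show ?thesis
    unfolding q q0 s .
qed

lemma gap_ge_line:
  assumes pd: "im_ge c p q r" "c > 0" and t: "t \<ge> 0"
  obtains X where "\<And>s. Re s \<ge> X \<Longrightarrow> gap_ge t (p + 2 * \<i> * s) (q - \<i> * s) (r + 2 * \<i> * s)"
proof
  define M where "M = (\<Sum>i\<in>{0, 1, 2, 3}. qform (Im p) (Im q) (Im r) (half1 i) (half2 i))"
  have nn: "qform (Im p) (Im q) (Im r) u v \<ge> 0" for u v
    using pd order_trans[of 0 "c * (u\<^sup>2 + v\<^sup>2)"] by (simp add: im_ge_def)
  have M: "qform (Im p) (Im q) (Im r) (half1 i) (half2 i) \<le> M" if "i \<in> {0, 1, 2, 3}" for i
    unfolding M_def using that nn by (intro member_le_sum) auto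
  have M0: "M \<ge> 0" unfolding M_def by (intro sum_nonneg nn)
  \<comment> \<open>The factor 3/2 inverts the constant of \<open>hexagonal_gap\<close>. The term 4M
    pays for the values of the given form at the half-integral vectors, as squared lengths are at
    least 1/4.\<close>
  fix s assume s: "Re s \<ge> 3 / 2 * (t + 4 * M)"
  define x where "x = Re s"
  have x: "x \<ge> 3 / 2 * (t + 4 * M)" "x \<ge> 0" using s t M0 by (auto simp: x_def intro: order_trans[rotated])
  show "gap_ge t (p + 2 * \<i> * s) (q - \<i> * s) (r + 2 * \<i> * s)"
    unfolding gap_ge_def
  proof (intro ballI allI impI)
    fix i m n assume i: "i \<in> {0, 1, 2, 3::nat}" and mn: "(m, n) \<notin> min_points i"
    define u v where "u = of_int m + half1 i" and "v = of_int n + half2 i"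
    have sp: "qform (Im (p + 2 * \<i> * s)) (Im (q - \<i> * s)) (Im (r + 2 * \<i> * s)) u v = qform (Im p) (Im q) (Im r) u v + x * qform 2 (-1) 2 u v" for u v
      by (simp add: qform_def x_def algebra_simps)
    have "u\<^sup>2 + v\<^sup>2 \<ge> 1/4" using nonmin_norm_ge[OF i mn] by (simp add: u_def v_def)
    then have "4 * M * (1/4) \<le> 4 * M * (u\<^sup>2 + v\<^sup>2)" using M0 by (intro mult_left_mono) auto
    moreover have "x * (2 / 3 * (u\<^sup>2 + v\<^sup>2)) \<le> x * (qform 2 (-1) 2 u v - qform 2 (-1) 2 (half1 i) (half2 i))"
      using hexagonal_gap[OF i mn] x by (intro mult_left_mono) (auto simp: u_def v_def)
    moreover have "(t + 4 * M) * (u\<^sup>2 + v\<^sup>2) \<le> (2 / 3 * x) * (u\<^sup>2 + v\<^sup>2)"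
      using x by (intro mult_right_mono) auto
    ultimately show "t * ((of_int m + half1 i)\<^sup>2 + (of_int n + half2 i)\<^sup>2) \<le>
        qform (Im (p + 2 * \<i> * s)) (Im (q - \<i> * s)) (Im (r + 2 * \<i> * s)) (of_int m + half1 i) (of_int n + half2 i) -
        qform (Im (p + 2 * \<i> * s)) (Im (q - \<i> * s)) (Im (r + 2 * \<i> * s)) (half1 i) (half2 i)"
      unfolding sp u_def[symmetric] v_def[symmetric]
      using M[OF i] nn[of u v] by (simp add: algebra_simps)
  qed
qed

text \<open>The hexagonal form is at most 3 |x|^2, so going back to Re s > -c/6 costs at most c/2.
  The resulting half-plane joins s = 0 to the region where \<open>gap_ge\<close> holds.\<close>

lemma im_ge_line:
  assumes pd: "im_ge c p q r" "c > 0" and s: "Re s > - c / 6"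
  shows "im_ge (c / 2) (p + 2 * \<i> * s) (q - \<i> * s) (r + 2 * \<i> * s)"
  unfolding im_ge_def
proof (intro allI)
  fix u v
  define x where "x = Re s"
  have sp: "qform (Im (p + 2 * \<i> * s)) (Im (q - \<i> * s)) (Im (r + 2 * \<i> * s)) u v = qform (Im p) (Im q) (Im r) u v + x * qform 2 (-1) 2 u v"
    by (simp add: qform_def x_def algebra_simps)
  have a: "qform 2 (-1) 2 u v = (u\<^sup>2 + v\<^sup>2) + (u - v)\<^sup>2" "qform 2 (-1) 2 u v = 3 * (u\<^sup>2 + v\<^sup>2) - (u + v)\<^sup>2"
    unfolding qform_def by algebra+
  have b: "0 \<le> qform 2 (-1) 2 u v" unfolding a(1) by simp
  have "- c / 6 * qform 2 (-1) 2 u v \<le> x * qform 2 (-1) 2 u v"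
    using s b by (intro mult_right_mono) (auto simp: x_def)
  moreover have "c / 6 * qform 2 (-1) 2 u v \<le> c / 6 * (3 * (u\<^sup>2 + v\<^sup>2))"
    unfolding a(2) using pd by (intro mult_left_mono) auto
  moreover have "c * (u\<^sup>2 + v\<^sup>2) \<le> qform (Im p) (Im q) (Im r) u v"
    using pd by (simp add: im_ge_def)
  ultimately show "c / 2 * (u\<^sup>2 + v\<^sup>2) \<le> qform (Im (p + 2 * \<i> * s)) (Im (q - \<i> * s)) (Im (r + 2 * \<i> * s)) u v"
    unfolding sp by (simp add: algebra_simps)
qed

theorem wronskian_theta_nulls:
  assumes pd: "im_ge c p q r" "c > 0"
  shows "wronskian (2 * p) (2 * q) (2 * r) = - (of_real pi ^ 6 / 8) * (null4 p q r * null6 p q r)"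
proof -
  obtain t1 where t1: "t1 \<ge> 1" and W: "\<And>p q r c. im_ge c p q r \<Longrightarrow> c > 0 \<Longrightarrow> gap_ge t1 p q r \<Longrightarrow>
       wronskian (2 * p) (2 * q) (2 * r) = - (of_real pi ^ 6 / 8) * (null4 p q r * null6 p q r)"
    using wronskian_domain by blast
  obtain X where X: "\<And>s. Re s \<ge> X \<Longrightarrow> gap_ge t1 (p + 2 * \<i> * s) (q - \<i> * s) (r + 2 * \<i> * s)"
    using gap_ge_line[OF pd, of t1] t1 by auto
  define P where "P = (\<lambda>s. p + 2 * \<i> * s)"
  define Q where "Q = (\<lambda>s. q - \<i> * s)"
  define R where "R = (\<lambda>s. r + 2 * \<i> * s)"
  define S where "S = {s. Re s > - c / 6}"
  define U where "U = {s. Re s > max X 0}"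
  have S: "open S" "connected S"
    unfolding S_def by (auto intro!: open_halfspace_Re_gt convex_connected convex_halfspace_Re_gt)
  have U: "open U" "U \<subseteq> S" "U \<noteq> {}"
  proof -
    show "open U" unfolding U_def by (rule open_halfspace_Re_gt)
    show "U \<subseteq> S" using pd unfolding U_def S_def by auto
    have "of_real (max X 0 + 1) \<in> U" by (auto simp: U_def max_def)
    then show "U \<noteq> {}" by blast
  qed
  have pdS: "im_ge (c / 2) (P s) (Q s) (R s)" if "s \<in> S" for s
    unfolding P_def Q_def R_def using im_ge_line[OF pd] that by (simp add: S_def)
  have hol: "P holomorphic_on S" "Q holomorphic_on S" "R holomorphic_on S"
    unfolding P_def Q_def R_def by (auto intro!: holomorphic_intros)
  have H: "(\<lambda>s. theta2 a b j k (P s) (Q s) (R s) z w) holomorphic_on S" for a b j k z w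
    by (rule theta2_holomorphic[OF S(1) _ hol _ _ pdS, where R = "max (norm z) (norm w)"]) (use pd in auto)
  have H2: "(\<lambda>s. theta2 a b j k (2 * P s) (2 * Q s) (2 * R s) z w) holomorphic_on S" for a b j k z w
    by (rule theta2_holomorphic[OF S(1) _ _ _ _ _ _ im_ge_double[OF pdS], where R = "max (norm z) (norm w)"])
       (use pd in \<open>auto intro!: holomorphic_intros hol\<close>)
  have "wronskian (2 * P 0) (2 * Q 0) (2 * R 0) = - (of_real pi ^ 6 / 8) * (null4 (P 0) (Q 0) (R 0) * null6 (P 0) (Q 0) (R 0))"
  proof (rule analytic_continuation_open[OF U(1) S(1) U(3) S(2) U(2), where z = 0
        and f = "\<lambda>s. wronskian (2 * P s) (2 * Q s) (2 * R s)"
        and g = "\<lambda>s. - (of_real pi ^ 6 / 8) * (null4 (P s) (Q s) (R s) * null6 (P s) (Q s) (R s))"])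
    show "(\<lambda>s. wronskian (2 * P s) (2 * Q s) (2 * R s)) holomorphic_on S"
      unfolding wronskian_def det4_def minor4_def by (intro holomorphic_intros H2)
    show "(\<lambda>s. - (of_real pi ^ 6 / 8) * (null4 (P s) (Q s) (R s) * null6 (P s) (Q s) (R s))) holomorphic_on S"
      unfolding null4_def null6_def by (intro holomorphic_intros H)
    show "0 \<in> S" using pd by (simp add: S_def)
    fix s assume s: "s \<in> U"
    show "wronskian (2 * P s) (2 * Q s) (2 * R s) = - (of_real pi ^ 6 / 8) * (null4 (P s) (Q s) (R s) * null6 (P s) (Q s) (R s))"
      by (rule W[OF pdS]) (use s U pd X in \<open>auto simp: P_def Q_def R_def U_def\<close>)
  qed
  then show ?thesis by (simp add: P_def Q_def R_def)
qed

section \<open>Theta functions with characteristics\<close>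

text \<open>The witness is determinant over trace: for a symmetric 2 by 2 matrix A with form Q,
  Cayley-Hamilton gives tr(A) Q(x) = det(A) |x|^2 + |A x|^2.\<close>

lemma im_ge_exI:
  assumes "\<And>u v. (u, v) \<noteq> (0, 0) \<Longrightarrow> qform (Im p) (Im q) (Im r) u v > 0"
  obtains c where "im_ge c p q r" "c > 0"
proof -
  define a b d where "a = Im p" and "b = Im q" and "d = Im r"
  have pos: "qform a b d u v > 0" if "(u, v) \<noteq> (0, 0)" for u v
    using assms[OF that] by (simp add: a_def b_def d_def)
  have a: "a > 0" using pos[of 1 0] by (simp add: qform_def)
  have d: "d > 0" using pos[of 0 1] by (simp add: qform_def)
  have "qform a b d (- b) a = a * (a * d - b\<^sup>2)" unfolding qform_def by algebra
  then have D: "a * d - b\<^sup>2 > 0" using pos[of "- b" a] a by (simp add: zero_less_mult_iff)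
  have "(a * d - b\<^sup>2) / (a + d) * (u\<^sup>2 + v\<^sup>2) \<le> qform a b d u v" for u v
  proof -
    have "(a + d) * qform a b d u v = (a * d - b\<^sup>2) * (u\<^sup>2 + v\<^sup>2) + ((a * u + b * v)\<^sup>2 + (b * u + d * v)\<^sup>2)"
      unfolding qform_def by algebra
    moreover have "0 \<le> (a * u + b * v)\<^sup>2 + (b * u + d * v)\<^sup>2" by simp
    ultimately have "(a * d - b\<^sup>2) * (u\<^sup>2 + v\<^sup>2) \<le> (a + d) * qform a b d u v" by linarith
    then show ?thesis using a d by (simp add: pos_divide_le_eq mult.commute)
  qed
  then have "im_ge ((a * d - b\<^sup>2) / (a + d)) p q r" by (simp add: im_ge_def a_def b_def d_def)
  moreover have "(a * d - b\<^sup>2) / (a + d) > 0" using a d D by simp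
  ultimately show ?thesis using that by blast
qed

section \<open>Matrices and vectors in coordinates\<close>

lemma siegel_qform:
  fixes \<tau> :: "complex^2^2"
  shows "\<tau> \<in> siegel_upper_half_space \<longleftrightarrow> \<tau>$2$1 = \<tau>$1$2 \<and>
     (\<forall>u v. (u, v) \<noteq> (0, 0) \<longrightarrow> qform (Im (\<tau>$1$1)) (Im (\<tau>$1$2)) (Im (\<tau>$2$2)) u v > 0)"
proof -
  have t: "transpose \<tau> = \<tau> \<longleftrightarrow> \<tau>$2$1 = \<tau>$1$2"
    by (auto simp: vec_eq_iff transpose_def forall_2)
  have q: "x \<bullet> ((\<chi> i j. Im (\<tau> $ i $ j)) *v x) = qform (Im (\<tau>$1$1)) (Im (\<tau>$1$2)) (Im (\<tau>$2$2)) (x$1) (x$2)"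
    if "\<tau>$2$1 = \<tau>$1$2" for x :: "real^2"
    by (simp add: inner_vec_def sum_2 matrix_vector_mult_def qform_def that power2_eq_square algebra_simps)
  have all: "(\<forall>x::real^2. x \<noteq> 0 \<longrightarrow> P (x$1) (x$2)) \<longleftrightarrow> (\<forall>u v. (u, v) \<noteq> (0, 0) \<longrightarrow> P u v)" for P :: "real \<Rightarrow> real \<Rightarrow> bool"
  proof (intro iffI allI impI)
    fix u v :: real assume A: "\<forall>x::real^2. x \<noteq> 0 \<longrightarrow> P (x$1) (x$2)" "(u, v) \<noteq> (0, 0)"
    then show "P u v" using A(1)[rule_format, of "vector [u, v]"] by (auto simp: vec_eq_iff forall_2)
  qed (auto simp: vec_eq_iff forall_2)
  show ?thesis
  proof (cases "\<tau>$2$1 = \<tau>$1$2")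
    case True
    show ?thesis
      unfolding siegel_upper_half_space_def mem_Collect_eq t q[OF True]
        all[of "\<lambda>u v. qform (Im (\<tau>$1$1)) (Im (\<tau>$1$2)) (Im (\<tau>$2$2)) u v > 0"] ..
  qed (simp add: siegel_upper_half_space_def t)
qed

lemma siegel_pointE:
  fixes \<tau> :: "complex^2^2"
  assumes "\<tau> \<in> siegel_upper_half_space"
  obtains c where "siegel_point (\<tau>$1$1) (\<tau>$1$2) (\<tau>$2$2) c"
  using assms im_ge_exI[of "\<tau>$1$1" "\<tau>$1$2" "\<tau>$2$2"] unfolding siegel_qform siegel_point_def by metis

lemma theta_char_theta2:
  fixes \<tau> :: "complex^2^2"
  assumes "\<tau>$2$1 = \<tau>$1$2" "a$1 = of_real \<alpha>" "a$2 = of_real \<beta>"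
  shows "theta_char a b z \<tau> = theta2 \<alpha> \<beta> 0 0 (\<tau>$1$1) (\<tau>$1$2) (\<tau>$2$2) (z$1 + b$1) (z$2 + b$2)"
  unfolding theta_char_def theta2_def
proof (rule infsum_reindex_bij_witness[where i = "\<lambda>(m, n). vector [m, n]" and j = "\<lambda>v. (v$1, v$2)"])
  fix m :: "int^2"
  define x y where "x = of_int (m$1) + \<alpha>" and "y = of_int (m$2) + \<beta>"
  define U where "U = cvec_of_int m + a"
  have U: "U$1 = of_real x" "U$2 = of_real y"
    by (simp_all add: U_def x_def y_def cvec_of_int_def assms)
  show "theta_term \<alpha> \<beta> 0 0 (\<tau>$1$1) (\<tau>$1$2) (\<tau>$2$2) (z$1 + b$1) (z$2 + b$2) (m$1, m$2) =
     (let u = cvec_of_int m + a in exp (of_real pi * \<i> * cpair u (\<tau> *v u) + 2 * of_real pi * \<i> * cpair u (z + b)))"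
    unfolding Let_def U_def[symmetric] cpair_def theta_term_def prod.case power_0 mult_1 x_def[symmetric] y_def[symmetric]
    unfolding matrix_vector_mult_def vec_lambda_beta sum_2 U vector_add_component assms(1)
    by (rule arg_cong[where f = exp]) (simp add: power2_eq_square algebra_simps)
qed (auto simp: vec_eq_iff forall_2)

lemma riemann_theta_theta2:
  fixes \<tau> :: "complex^2^2"
  assumes "\<tau>$2$1 = \<tau>$1$2"
  shows "riemann_theta z \<tau> = theta2 0 0 0 0 (\<tau>$1$1) (\<tau>$1$2) (\<tau>$2$2) (z$1) (z$2)"
  unfolding riemann_theta_def by (subst theta_char_theta2[where \<alpha> = 0 and \<beta> = 0]) (use assms in auto)

lemma partial_deriv_theta2:
  assumes "siegel_point p q r c"
  shows "partial_deriv 1 (\<lambda>z::complex^2. theta2 a b j k p q r (z$1) (z$2)) = (\<lambda>z. theta2 a b (Suc j) k p q r (z$1) (z$2))"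
    "partial_deriv 2 (\<lambda>z::complex^2. theta2 a b j k p q r (z$1) (z$2)) = (\<lambda>z. theta2 a b j (Suc k) p q r (z$1) (z$2))"
  using siegel_point.pd[OF assms] siegel_point.cpos[OF assms]
  by (auto simp: partial_deriv_def fun_eq_iff intro!: DERIV_imp_deriv theta2_deriv1 theta2_deriv2)

lemma theta_derivs_theta2:
  fixes \<tau> :: "complex^2^2"
  assumes s: "\<tau>$2$1 = \<tau>$1$2" and c: "siegel_point (\<tau>$1$1) (\<tau>$1$2) (\<tau>$2$2) c"
  defines "T \<equiv> \<lambda>j k z. theta2 0 0 j k (\<tau>$1$1) (\<tau>$1$2) (\<tau>$2$2) (z$1) (z$2)"
  shows "theta_d1 1 z \<tau> = T 1 0 z" "theta_d1 2 z \<tau> = T 0 1 z"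
    "theta_d2 1 1 z \<tau> = T 2 0 z" "theta_d2 1 2 z \<tau> = T 1 1 z" "theta_d2 2 2 z \<tau> = T 0 2 z"
  unfolding theta_d1_def theta_d2_def riemann_theta_theta2[OF s] partial_deriv_theta2[OF c] T_def
  by (simp_all add: numeral_2_eq_2)

section \<open>The ten even characteristics\<close>

definition charvec :: "complex \<times> complex \<times> complex \<times> complex \<Rightarrow> (complex^2) \<times> (complex^2)" where
  "charvec = (\<lambda>(a1, a2, b1, b2). (vector [a1, a2], vector [b1, b2]))"

definition even_quads :: "(complex \<times> complex \<times> complex \<times> complex) set" where
  "even_quads = {(0, 0, 0, 0), (0, 0, 1/2, 0), (0, 0, 0, 1/2), (0, 0, 1/2, 1/2),
     (1/2, 0, 0, 0), (1/2, 0, 0, 1/2), (0, 1/2, 0, 0), (0, 1/2, 1/2, 0), (1/2, 1/2, 0, 0), (1/2, 1/2, 1/2, 1/2)}"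

lemma exp_2pi_char: "a \<in> {0, 1/2} \<Longrightarrow> exp (2 * of_real pi * \<i> * of_real a) = (if a \<noteq> 0 then -1 else 1 :: complex)"
  by (elim insertE emptyE; hypsubst) simp_all

text \<open>Reflection replaces b by -b, and returning by the integral period 2b costs the parity
  sign of the characteristic.\<close>

lemma theta2_char_uminus:
  assumes a: "a1 \<in> {0, 1/2}" "a2 \<in> {0, 1/2}" and b: "b1 \<in> {0, 1/2}" "b2 \<in> {0, 1/2}"
  shows "theta2 a1 a2 0 0 p q r (- z + b1) (- w + b2) =
    (if a1 \<noteq> 0 \<and> b1 \<noteq> 0 then -1 else 1) * (if a2 \<noteq> 0 \<and> b2 \<noteq> 0 then -1 else 1) * theta2 a1 a2 0 0 p q r (z + b1) (w + b2)"
proof -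
  have 1: "theta2 a1 a2 0 0 p q r (x + b1) y = (if a1 \<noteq> 0 \<and> b1 \<noteq> 0 then -1 else 1) * theta2 a1 a2 0 0 p q r (x - b1) y" for x y
  proof -
    have e: "x + 1/2 = (x - 1/2) + 1" by simp
    show ?thesis
    proof (cases "b1 = 0")
      case False
      then have b1: "b1 = 1/2" using b by simp
      show ?thesis using b1 unfolding b1 e theta2_period1 exp_2pi_char[OF a(1)] by simp
    qed simp
  qed
  have 2: "theta2 a1 a2 0 0 p q r x (y + b2) = (if a2 \<noteq> 0 \<and> b2 \<noteq> 0 then -1 else 1) * theta2 a1 a2 0 0 p q r x (y - b2)" for x y
  proof -
    have e: "y + 1/2 = (y - 1/2) + 1" by simp
    show ?thesis
    proof (cases "b2 = 0")
      case False
      then have b2: "b2 = 1/2" using b by simp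
      show ?thesis using b2 unfolding b2 e theta2_period2 exp_2pi_char[OF a(2)] by simp
    qed simp
  qed
  have m: "- z + b1 = - (z - b1)" "- w + b2 = - (w - b2)" by simp_all
  show ?thesis
    unfolding m theta2_uminus[OF half_Ints[OF a(1)] half_Ints[OF a(2)]] 1 2 by simp
qed

lemma odd_leading_terms:
  "w \<in> {0, 1/2} \<Longrightarrow> leading 1 1 0 (1/2) w \<noteq> 0" "z \<in> {0, 1/2} \<Longrightarrow> leading 2 0 1 z (1/2) \<noteq> 0"
  "leading 3 1 0 (1/2) 0 \<noteq> 0" "leading 3 1 0 0 (1/2) \<noteq> 0"
proof -
  have "2 * of_real pi * \<i> * (1/4) = \<i> * of_real (pi / 2)" "2 * of_real pi * \<i> * (- (1/4)) = - (\<i> * of_real (pi / 2))" by simp_all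
  then have "exp (2 * of_real pi * \<i> * (1/4)) = \<i>" "exp (2 * of_real pi * \<i> * (- (1/4))) = - \<i>"
    by (simp_all only: exp_minus cis_conv_exp[symmetric] cis_pi_half) simp
  then have e: "exp (of_real pi * \<i> / 2) = \<i>" "exp (- (of_real pi * \<i> / 2)) = - \<i>"
    "exp (\<i> * of_real pi / 2) = \<i>" "exp (- (\<i> * of_real pi / 2)) = - \<i>"
    by (simp_all add: mult.commute)
  have ne: "\<i> \<noteq> - \<i>" by (simp add: complex_eq_iff)
  show "w \<in> {0, 1/2} \<Longrightarrow> leading 1 1 0 (1/2) w \<noteq> 0" "z \<in> {0, 1/2} \<Longrightarrow> leading 2 0 1 z (1/2) \<noteq> 0"
    "leading 3 1 0 (1/2) 0 \<noteq> 0" "leading 3 1 0 0 (1/2) \<noteq> 0"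
    by (simp_all add: leading_def min_points_def leading_summand_def e ne)
qed

text \<open>Evenness is an identity in z and \<open>\<tau>\<close>, so ruling out an odd
  characteristic requires a period matrix where its function is not identically zero. Its null
  vanishes, so a first derivative is tested instead, on the orbit 2^n of a point of the hexagonal
  line.\<close>

lemma odd_theta_nonzero:
  assumes i: "i \<in> {0, 1, 2, 3}" and l: "leading i j k b1 b2 \<noteq> 0" "(j, k) = (1, 0) \<or> (j, k) = (0, 1)" and b: "Im b1 = 0" "Im b2 = 0"
  shows "\<exists>p q r c z w. siegel_point p q r c \<and> theta2 (half1 i) (half2 i) 0 0 p q r z w \<noteq> 0"
proof -
  have "im_ge 1 \<i> 0 \<i>" by (simp add: im_ge_def qform_def)
  then obtain X where X: "\<And>s. Re s \<ge> X \<Longrightarrow> gap_ge 1 (\<i> + 2 * \<i> * s) (0 - \<i> * s) (\<i> + 2 * \<i> * s)"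
    using gap_ge_line[of 1 \<i> 0 \<i> 1] by auto
  define s :: complex where "s = of_real (max X 0)"
  define p where "p = \<i> + 2 * \<i> * s"
  define q where "q = 0 - \<i> * s"
  have d: "gap_ge 1 p q p" unfolding p_def q_def by (rule X) (simp add: s_def)
  have pd: "im_ge (1/2) p q p"
    unfolding p_def q_def by (rule im_ge_line[OF \<open>im_ge 1 \<i> 0 \<i>\<close>]) (simp_all add: s_def max_def)
  have "(\<lambda>n. ntheta i j k (2 ^ n * p) (2 ^ n * q) (2 ^ n * p) b1 b2) \<longlonglongrightarrow> leading i j k b1 b2"
    by (rule leading_limit[OF i pd _ d]) (use b in auto)
  then have "eventually (\<lambda>n. ntheta i j k (2 ^ n * p) (2 ^ n * q) (2 ^ n * p) b1 b2 \<noteq> 0) sequentially"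
    using l(1) by (rule tendsto_imp_eventually_ne)
  then obtain n where n: "theta2 (half1 i) (half2 i) j k (2 ^ n * p) (2 ^ n * q) (2 ^ n * p) b1 b2 \<noteq> 0"
    by (auto simp: eventually_sequentially ntheta_def)
  have pdn: "im_ge (2 ^ n * (1/2)) (2 ^ n * p) (2 ^ n * q) (2 ^ n * p)" "2 ^ n * (1/2 :: real) > 0"
    using im_ge_scale[OF pd, of "2 ^ n"] by simp_all
  have "\<exists>z w. theta2 (half1 i) (half2 i) 0 0 (2 ^ n * p) (2 ^ n * q) (2 ^ n * p) z w \<noteq> 0"
  proof (rule ccontr)
    assume "\<not> ?thesis"
    then have z: "theta2 (half1 i) (half2 i) 0 0 (2 ^ n * p) (2 ^ n * q) (2 ^ n * p) z w = 0" for z w by blast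
    have "theta2 (half1 i) (half2 i) (Suc 0) 0 (2 ^ n * p) (2 ^ n * q) (2 ^ n * p) z w = 0" for z w
      using theta2_deriv1[OF pdn, of "half1 i" "half2 i" 0 0 w z] unfolding z by (rule DERIV_unique) simp
    moreover have "theta2 (half1 i) (half2 i) 0 (Suc 0) (2 ^ n * p) (2 ^ n * q) (2 ^ n * p) z w = 0" for z w
      using theta2_deriv2[OF pdn, of "half1 i" "half2 i" 0 0 z w] unfolding z by (rule DERIV_unique) simp
    ultimately show False using n l(2) by auto
  qed
  with pdn show ?thesis unfolding siegel_point_def by blast
qed

lemma even_quadsI:
  assumes "\<alpha> \<in> {0, 1/2}" "\<beta> \<in> {0, 1/2}" "x \<in> {0, 1/2}" "y \<in> {0, 1/2}"
    "(if \<alpha> \<noteq> 0 \<and> x \<noteq> 0 then -1 else 1) * (if \<beta> \<noteq> 0 \<and> y \<noteq> 0 then -1 else 1) = (1 :: complex)"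
  shows "(of_real \<alpha>, of_real \<beta>, x, y) \<in> even_quads"
  using assms by (elim insertE emptyE; hypsubst; simp add: even_quads_def)

lemma even_theta_characteristics_eq: "even_theta_characteristics = charvec ` even_quads"
proof (intro equalityI subsetI)
  fix x assume "x \<in> charvec ` even_quads"
  then obtain a1 a2 b1 b2 where x: "x = charvec (a1, a2, b1, b2)" and m: "(a1, a2, b1, b2) \<in> even_quads"
    by (metis imageE prod_cases4)
  have r: "\<exists>\<alpha> \<beta>. a1 = of_real \<alpha> \<and> a2 = of_real \<beta> \<and> \<alpha> \<in> {0, 1/2} \<and> \<beta> \<in> {0, 1/2} \<and>
      (if \<alpha> \<noteq> 0 \<and> b1 \<noteq> 0 then -1 else 1) * (if \<beta> \<noteq> 0 \<and> b2 \<noteq> 0 then -1 else 1) = (1 :: complex)" 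
    using m unfolding even_quads_def
    by (intro exI[of _ "Re a1"] exI[of _ "Re a2"]) (auto simp: complex_eq_iff)
  then obtain \<alpha> \<beta> where ab: "a1 = of_real \<alpha>" "a2 = of_real \<beta>" "\<alpha> \<in> {0, 1/2}" "\<beta> \<in> {0, 1/2}"
    and sgn: "(if \<alpha> \<noteq> 0 \<and> b1 \<noteq> 0 then -1 else 1) * (if \<beta> \<noteq> 0 \<and> b2 \<noteq> 0 then -1 else 1) = (1 :: complex)" by blast
  have b: "b1 \<in> {0, 1/2}" "b2 \<in> {0, 1/2}" using m by (auto simp: even_quads_def)
  have "theta_char (vector [a1, a2]) (vector [b1, b2]) (- z) \<tau> = theta_char (vector [a1, a2]) (vector [b1, b2]) z \<tau>"
    if "\<tau> \<in> siegel_upper_half_space" for z :: "complex^2" and \<tau>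
  proof -
    have s: "\<tau>$2$1 = \<tau>$1$2" using that by (simp add: siegel_qform)
    have T: "theta_char (vector [a1, a2]) y x \<tau> = theta2 \<alpha> \<beta> 0 0 (\<tau>$1$1) (\<tau>$1$2) (\<tau>$2$2) (x$1 + y$1) (x$2 + y$2)" for x y
      by (rule theta_char_theta2[OF s]) (simp_all add: ab)
    show ?thesis
      using theta2_char_uminus[OF ab(3,4) b, of "\<tau>$1$1" "\<tau>$1$2" "\<tau>$2$2" "z$1" "z$2"] unfolding sgn T
      by simp
  qed
  moreover have "(vector [a1, a2] :: complex^2, vector [b1, b2]) \<in> theta_characteristics"
  proof -
    have "a1 \<in> {0, 1/2}" "a2 \<in> {0, 1/2}" using m by (auto simp: even_quads_def)
    with b show ?thesis unfolding theta_characteristics_def forall_2 mem_Collect_eq prod.case by simp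
  qed
  ultimately show "x \<in> even_theta_characteristics"
    by (simp add: x charvec_def even_theta_characteristics_def)
next
  fix x :: "(complex^2) \<times> (complex^2)" assume x: "x \<in> even_theta_characteristics"
  obtain a b where xab: "x = (a, b)" by (cases x)
  have ab: "a$1 \<in> {0, 1/2}" "a$2 \<in> {0, 1/2}" "b$1 \<in> {0, 1/2}" "b$2 \<in> {0, 1/2}"
    and ev: "\<And>\<tau> z. \<tau> \<in> siegel_upper_half_space \<Longrightarrow> theta_char a b (- z) \<tau> = theta_char a b z \<tau>"
    using x unfolding xab even_theta_characteristics_def theta_characteristics_def by (auto simp: forall_2)
  obtain \<alpha> \<beta> where al: "a$1 = of_real \<alpha>" "a$2 = of_real \<beta>" "\<alpha> \<in> {0, 1/2}" "\<beta> \<in> {0, 1/2}"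
  proof (rule that[of "Re (a$1)" "Re (a$2)"])
    show "a$1 = of_real (Re (a$1))" "a$2 = of_real (Re (a$2))" "Re (a$1) \<in> {0, 1/2}" "Re (a$2) \<in> {0, 1/2}"
      using ab by (auto simp: complex_eq_iff)
  qed
  define sgn :: complex where "sgn = (if \<alpha> \<noteq> 0 \<and> b$1 \<noteq> 0 then -1 else 1) * (if \<beta> \<noteq> 0 \<and> b$2 \<noteq> 0 then -1 else 1)"
  have "sgn = 1"
  proof (rule ccontr)
    assume sg: "sgn \<noteq> 1"
    then have sgn: "sgn = -1" by (auto simp: sgn_def split: if_splits)
    \<comment> \<open>With parity sign -1 the function is both even and odd.\<close>
    have zero: "theta2 \<alpha> \<beta> 0 0 p q r z w = 0" if "siegel_point p q r c" for p q r c z w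
    proof -
      define \<tau> :: "complex^2^2" where "\<tau> = vector [vector [p, q], vector [q, r]]"
      have t: "\<tau>$1$1 = p" "\<tau>$1$2 = q" "\<tau>$2$1 = q" "\<tau>$2$2 = r" by (simp_all add: \<tau>_def)
      have "qform (Im p) (Im q) (Im r) u v > 0" if "(u, v) \<noteq> (0, 0)" for u v
      proof -
        have "u\<^sup>2 + v\<^sup>2 > 0" using that by (auto simp: sum_power2_gt_zero_iff)
        then have "c * (u\<^sup>2 + v\<^sup>2) > 0"
          using siegel_point.cpos[OF \<open>siegel_point p q r c\<close>] by simp
        also have "\<dots> \<le> qform (Im p) (Im q) (Im r) u v"
          using siegel_point.pd[OF \<open>siegel_point p q r c\<close>] by (simp add: im_ge_def)
        finally show ?thesis .
      qed
      then have "\<tau> \<in> siegel_upper_half_space" unfolding siegel_qform t by blast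
      from ev[OF this, of "vector [z - b$1, w - b$2]"]
      have "theta2 \<alpha> \<beta> 0 0 p q r (- (z - b$1) + b$1) (- (w - b$2) + b$2) = theta2 \<alpha> \<beta> 0 0 p q r z w"
        by (simp add: theta_char_theta2[of \<tau> a \<alpha> \<beta>] t al)
      then show ?thesis
        using theta2_char_uminus[OF al(3,4) ab(3,4), of p q r "z - b$1" "w - b$2"] unfolding sgn_def[symmetric] sgn by simp
    qed
    have nz: "False" if nz: "i \<in> {0, 1, 2, 3}" "half1 i = \<alpha>" "half2 i = \<beta>" "leading i j k (b$1) (b$2) \<noteq> 0" "(j, k) = (1, 0) \<or> (j, k) = (0, 1)" for i j k
    proof -
      have im: "Im x = 0" if "x \<in> {0, 1/2}" for x using that by (elim insertE emptyE; hypsubst) simp_all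
      obtain p q r c z w where "siegel_point p q r c" "theta2 (half1 i) (half2 i) 0 0 p q r z w \<noteq> 0"
        using odd_theta_nonzero[OF nz(1,4,5) im[OF ab(3)] im[OF ab(4)]] by blast
      then show False using zero unfolding nz(2,3) by blast
    qed
    consider "\<alpha> = 1/2" "\<beta> = 0" "b$1 = 1/2" | "\<alpha> = 0" "\<beta> = 1/2" "b$2 = 1/2"
      | "\<alpha> = 1/2" "\<beta> = 1/2" "b$1 = 1/2" "b$2 = 0" | "\<alpha> = 1/2" "\<beta> = 1/2" "b$1 = 0" "b$2 = 1/2"
      using sg al(3,4) ab(3,4) unfolding sgn_def by (auto split: if_splits)
    then show False
    proof cases
      case 1
      show False by (rule nz[of 1 1 0]; (unfold 1)?; simp add: odd_leading_terms(1)[OF ab(4), unfolded One_nat_def])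
    next
      case 2
      show False by (rule nz[of 2 0 1]; (unfold 2)?; simp add: odd_leading_terms(2)[OF ab(3), unfolded One_nat_def])
    next
      case 3
      show False by (rule nz[of 3 1 0]; (unfold 3)?; simp add: odd_leading_terms(3)[unfolded One_nat_def])
    next
      case 4
      show False by (rule nz[of 3 1 0]; (unfold 4)?; simp add: odd_leading_terms(4)[unfolded One_nat_def])
    qed
  qed
  then have "(a$1, a$2, b$1, b$2) \<in> even_quads"
    unfolding al(1,2) sgn_def by (rule even_quadsI[OF al(3,4) ab(3,4)])
  moreover have "x = charvec (a$1, a$2, b$1, b$2)"
    by (simp add: xab charvec_def vec_eq_iff forall_2)
  ultimately show "x \<in> charvec ` even_quads" by blast
qed

lemma even_theta_product:
  fixes \<tau> :: "complex^2^2"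
  assumes s: "\<tau>$2$1 = \<tau>$1$2"
  shows "(\<Prod>(a, b)\<in>even_theta_characteristics. (theta_char a b 0 \<tau>)\<^sup>2) =
    (null4 (\<tau>$1$1) (\<tau>$1$2) (\<tau>$2$2) * null6 (\<tau>$1$1) (\<tau>$1$2) (\<tau>$2$2))\<^sup>2"
proof -
  have inj: "inj_on charvec even_quads"
    by (rule inj_onI) (auto simp: charvec_def vec_eq_iff forall_2)
  have T: "theta_char (vector [a1, a2]) (vector [b1, b2]) 0 \<tau> = theta2 (Re a1) (Re a2) 0 0 (\<tau>$1$1) (\<tau>$1$2) (\<tau>$2$2) b1 b2"
    if "a1 \<in> {0, 1/2}" "a2 \<in> {0, 1/2}" for a1 a2 b1 b2
    using that by (subst theta_char_theta2[OF s, of _ "Re a1" "Re a2"]) (auto simp: complex_eq_iff)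
  have "(\<Prod>(a, b)\<in>even_theta_characteristics. (theta_char a b 0 \<tau>)\<^sup>2) =
     (\<Prod>(a1, a2, b1, b2)\<in>even_quads. (theta_char (vector [a1, a2]) (vector [b1, b2]) 0 \<tau>)\<^sup>2)"
    unfolding even_theta_characteristics_eq prod.reindex[OF inj] by (simp add: charvec_def case_prod_unfold)
  also have "\<dots> = (null4 (\<tau>$1$1) (\<tau>$1$2) (\<tau>$2$2) * null6 (\<tau>$1$1) (\<tau>$1$2) (\<tau>$2$2))\<^sup>2"
    unfolding even_quads_def null4_def null6_def by (simp add: T power_mult_distrib mult_ac)
  finally show ?thesis .
qed

theorem theorem6p1:
  shows "\<exists>s\<in>{1, -1 :: complex}.
           \<forall>(z :: complex^2) (\<tau> :: complex^2^2).
             \<tau> \<in> siegel_upper_half_space \<longrightarrow> riemann_theta z \<tau> = 0 \<longrightarrow>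
             (eta z \<tau>) ^ 3 =
               s * of_real pi ^ 12
                 * (\<Prod>(a, b)\<in>even_theta_characteristics. (theta_char a b 0 \<tau>)\<^sup>2)
                 * riemann_theta (3 *s z) \<tau>"
proof (intro bexI[of _ "-1"] allI impI)
  fix z :: "complex^2" and \<tau> :: "complex^2^2"
  assume \<tau>: "\<tau> \<in> siegel_upper_half_space" and z: "riemann_theta z \<tau> = 0"
  obtain c where c: "siegel_point (\<tau>$1$1) (\<tau>$1$2) (\<tau>$2$2) c" using siegel_pointE[OF \<tau>] .
  then interpret siegel_point "\<tau>$1$1" "\<tau>$1$2" "\<tau>$2$2" c .
  have s: "\<tau>$2$1 = \<tau>$1$2" using \<tau> by (simp add: siegel_qform)
  define N where "N = null4 (\<tau>$1$1) (\<tau>$1$2) (\<tau>$2$2) * null6 (\<tau>$1$1) (\<tau>$1$2) (\<tau>$2$2)"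
  define t where "t = riemann_theta (3 *s z) \<tau>"
  \<comment> \<open>64 is the product of the chain-rule factors 4 of the three rows of second
    derivatives.\<close>
  have "det4 (kummer 0 0 0 0) (kummer 2 0 0 0) (kummer 1 1 0 0) (kummer 0 2 0 0) = 64 * wronskian (2 * \<tau>$1$1) (2 * \<tau>$1$2) (2 * \<tau>$2$2)"
    unfolding wronskian_def det4_def minor4_def kummer_def by (simp add: algebra_simps)
  also have "\<dots> = - 8 * of_real pi ^ 6 * N"
    unfolding wronskian_theta_nulls[OF pd cpos] N_def by simp
  finally have d: "det4 (kummer 0 0 0 0) (kummer 2 0 0 0) (kummer 1 1 0 0) (kummer 0 2 0 0) = - 8 * of_real pi ^ 6 * N" .
  have rtheta: "riemann_theta x \<tau> = rtheta 0 0 (x$1) (x$2)" for x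
    unfolding riemann_theta_theta2[OF s] rtheta_def ..
  have "(- 8 * of_real pi ^ 6 * N)\<^sup>2 * t = - 64 * (eta z \<tau>) ^ 3"
    using theta_divisor_cube[of "z$1" "z$2"] z unfolding d eta_def theta_derivs_theta2[OF s c] t_def
    by (simp add: rtheta rtheta_def)
  moreover have "(- 8 * of_real pi ^ 6 * N)\<^sup>2 * t = 64 * (of_real pi ^ 12 * N\<^sup>2 * t)"
    by (simp add: power_mult_distrib flip: power_mult)
  ultimately have "(eta z \<tau>) ^ 3 = - (of_real pi ^ 12 * N\<^sup>2 * t)"
    by algebra
  then show "(eta z \<tau>) ^ 3 = -1 * of_real pi ^ 12
      * (\<Prod>(a, b)\<in>even_theta_characteristics. (theta_char a b 0 \<tau>)\<^sup>2) * riemann_theta (3 *s z) \<tau>"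
    unfolding even_theta_product[OF s] N_def t_def by (simp add: mult.assoc)
qed simp

end
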